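(* There is a constant $C>0$ such that every $f\in\mathcal V=D(A_0^{1/2})$ has well-defined endpoint traces $f(0),f(\pi)$ (the endpoint evaluations extend continuously to $\mathcal V$) and satisfies \[ |f(0)|^2+|f(\pi)|^2\le C\left(\mathfrak a_0[f,f]^{3/4}\,\|f\|_{\mathcal H}^{1/2}+\|f\|_{\mathcal H}^2\right). \] Equivalently, there is a constant $C>0$ such that for every $\varepsilon\in(0,1]$ and every $f\in\mathcal V$, \[ |f(0)|^2+|f(\pi)|^2\le C\left(\varepsilon\,\mathfrak a_0[f,f]+\varepsilon^{-3}\|f\|_{\mathcal H}^2\right). \]
   Context: Let $\omega(\varphi)=(\sin\varphi)^{1/2}$ and $\mathcal H=L^2((0,\pi),\omega\,d\varphi)$. Let $\mathfrak a_0[f,g]=4\int_0^\pi\omega f'\,\overline{g'}\,d\varphi$ with form domain $\mathcal V=\{f\in\mathcal H: f\in H^1_{\mathrm{loc}}(0,\pi),\ \int_0^\pi\omega|f'|^2\,d\varphi<\infty\}$, normed by $\|f\|_{\mathcal V}^2=\mathfrak a_0[f,f]+\|f\|_{\mathcal H}^2$. This is a closed nonnegative form; $A_0$ is the associated self-adjoint operator, $A_0f=-4\omega^{-1}(\omega f')'$. Its eigenfunctions are $\Phi_n(\varphi)=\mathfrak h_n^{-1/2}C_n^{1/4}(\cos\varphi)$ ($C_n^{1/4}$ Gegenbauer polynomials, $\mathfrak h_n>0$ normalizing in $\mathcal H$), with eigenvalues $2n(2n+1)$; finite linear combinations of the $\Phi_n$ are continuous on $[0,\pi]$ and dense in $\mathcal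 V$. *)

theory Defs
  imports "HOL-Analysis.Analysis"
begin

definition weight :: "real \<Rightarrow> real" where
  "weight x = sqrt (sin x)"

definition weighted_measure :: "real measure" where
  "weighted_measure = density (lebesgue_on {0<..<pi}) (\<lambda>x. ennreal (weight x))"

text \<open>
  Elements of function spaces on \<open>(0,\<pi>)\<close> are represented by functions on the whole real line
  rather than by classes modulo almost everywhere equality; what happens outside \<open>(0,\<pi>)\<close> and on
  null sets is irrelevant, and \<open>norm_H\<close> and \<open>norm_V\<close> below are seminorms on representatives.
\<close>

definition space_H :: "(real \<Rightarrow> complex) set" where
  "space_H = {f \<in> borel_measurable weighted_measure.
     integrable weighted_measure (\<lambda>x. (cmod (f x))\<^sup>2)}"

definition norm_H :: "(real \<Rightarrow> complex) \<Rightarrow> real" where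
  "norm_H f = sqrt (LINT x|weighted_measure. (cmod (f x))\<^sup>2)"

definition test_functions :: "(real \<Rightarrow> real) set" where
  "test_functions = {\<psi>. (\<forall>k x. ((deriv ^^ k) \<psi>) field_differentiable (at x)) \<and>
     (\<exists>a b. 0 < a \<and> b < pi \<and> (\<forall>x. x \<notin> {a..b} \<longrightarrow> \<psi> x = 0))}"

definition L2_loc :: "(real \<Rightarrow> complex) set" where
  "L2_loc = {f \<in> borel_measurable (lebesgue_on {0<..<pi}).
     \<forall>K. compact K \<and> K \<subseteq> {0<..<pi} \<longrightarrow> integrable (lebesgue_on K) (\<lambda>x. (cmod (f x))\<^sup>2)}"

definition has_weak_deriv :: "(real \<Rightarrow> complex) \<Rightarrow> (real \<Rightarrow> complex) \<Rightarrow> bool" where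
  "has_weak_deriv f g \<longleftrightarrow> f \<in> L2_loc \<and> g \<in> L2_loc \<and>
     (\<forall>\<psi>\<in>test_functions.
        (LINT x|lebesgue_on {0<..<pi}. deriv \<psi> x *\<^sub>R f x) =
        - (LINT x|lebesgue_on {0<..<pi}. \<psi> x *\<^sub>R g x))"

definition H1_loc :: "(real \<Rightarrow> complex) set" where
  "H1_loc = {f. \<exists>g. has_weak_deriv f g}"

text \<open>The choice is immaterial: weak derivatives are unique almost everywhere on \<open>(0,\<pi>)\<close>.\<close>

definition weak_deriv :: "(real \<Rightarrow> complex) \<Rightarrow> real \<Rightarrow> complex" where
  "weak_deriv f = (SOME g. has_weak_deriv f g)"

definition space_V :: "(real \<Rightarrow> complex) set" where
  "space_V = {f \<in> space_H. f \<in> H1_loc \<and>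
     integrable weighted_measure (\<lambda>x. (cmod (weak_deriv f x))\<^sup>2)}"

definition form_a0 :: "(real \<Rightarrow> complex) \<Rightarrow> (real \<Rightarrow> complex) \<Rightarrow> complex" where
  "form_a0 f g = 4 * (LINT x|weighted_measure. weak_deriv f x * cnj (weak_deriv g x))"

definition norm_V :: "(real \<Rightarrow> complex) \<Rightarrow> real" where
  "norm_V f = sqrt (Re (form_a0 f f) + (norm_H f)\<^sup>2)"

text \<open>
  \<open>T\<close> is a linear functional on \<open>space_V\<close>, continuous for \<open>norm_V\<close>, that extends the evaluation
  \<open>f \<mapsto> f c\<close> from those members of \<open>space_V\<close> that are continuous on \<open>[0,\<pi>]\<close> (among them the
  finite linear combinations of the functions \<open>C\<^sub>n\<^sup>1\<^sup>/\<^sup>4(cos \<phi>)\<close>). Its values outside \<open>space_V\<close>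
  are unconstrained.
\<close>

definition endpoint_trace :: "real \<Rightarrow> ((real \<Rightarrow> complex) \<Rightarrow> complex) \<Rightarrow> bool" where
  "endpoint_trace c T \<longleftrightarrow>
     (\<forall>f\<in>space_V. \<forall>g\<in>space_V. T (\<lambda>x. f x + g x) = T f + T g) \<and>
     (\<forall>f\<in>space_V. \<forall>z. T (\<lambda>x. z * f x) = z * T f) \<and>
     (\<forall>f\<in>space_V. \<forall>e>0. \<exists>d>0. \<forall>g\<in>space_V.
        norm_V (\<lambda>x. g x - f x) < d \<longrightarrow> cmod (T g - T f) < e) \<and>
     (\<forall>f\<in>space_V. continuous_on {0..pi} f \<longrightarrow> T f = f c)"

end

theory Submission
  imports Defs
begin

text \<open>
  A function \<open>f\<close> in the form domain has a weak derivative \<open>g\<close> with \<open>\<integral>\<omega>|g|\<^sup>2 < \<infinity>\<close>. Near an endpoint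
  \<open>e\<close> the weight behaves like \<open>|x - e|\<close> to the power one half, so \<open>1/\<omega>\<close> is integrable and the
  Cauchy--Schwarz inequality gives two things: \<open>g\<close> is integrable on all of \<open>(0,\<pi>)\<close>, and, with a
  numerical constant, \<open>(\<integral>|g|)\<^sup>2 \<le> C |x - e|\<^bsup>1/2\<^esup> \<integral>\<omega>|g|\<^sup>2\<close> for the integral between \<open>e\<close> and
  \<open>x\<close> (\<open>integral_near_bound\<close>).

  Integrability of \<open>g\<close> makes \<open>f\<close> almost everywhere equal to a primitive of \<open>g\<close>
  (\<open>AE_eq_constant_plus_primitive\<close>), that is, to a function \<open>F\<close> that is continuous on the closed
  interval. This \<open>F\<close> is unique, and the trace of \<open>f\<close> at \<open>e\<close> is \<open>F e\<close>. Since \<open>F\<close> is itself a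
  continuous member of the form domain at distance zero from \<open>f\<close>, a functional that is continuous
  for the form norm and evaluates continuous functions has no other choice than \<open>F e\<close>.

  For the estimate, \<open>|F e|\<^sup>2 \<le> 2|f x|\<^sup>2 + 2|F x - F e|\<^sup>2\<close> is averaged over those \<open>x\<close> whose
  distance to \<open>e\<close> lies between \<open>r/2\<close> and \<open>r\<close>. There \<open>\<omega>\<close> is at least a multiple of \<open>r\<^bsup>1/2\<^esup>\<close>,
  which bounds the first term by \<open>r\<^bsup>-3/2\<^esup> \<integral>\<omega>|f|\<^sup>2\<close>, and the second is at most a multiple of
  \<open>r\<^bsup>1/2\<^esup> \<integral>\<omega>|g|\<^sup>2\<close>. The choice \<open>r = \<epsilon>\<^sup>2\<close> is the additive form of the inequality
  (\<open>endpoint_bound\<close>), and optimizing \<open>\<epsilon>\<close> is the multiplicative form (\<open>optimize_epsilon\<close>).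

  The weak derivative is defined by testing against smooth functions, so the primitive
  representation rests on the lemma of du Bois-Reymond, for which smooth bumps are built from
  \<open>exp (- 1/x)\<close>.
\<close>

section \<open>Smooth functions and test functions\<close>

definition smooth :: "(real \<Rightarrow> real) \<Rightarrow> bool" where
  "smooth f \<longleftrightarrow> (\<forall>k x. ((deriv ^^ k) f) field_differentiable (at x))"

text \<open>
  Smoothness is a greatest fixed point: a set of differentiable functions that is closed under
  differentiation contains only smooth functions. Finding such a set replaces formulas for higher
  derivatives (Leibniz, chain rule) in all closure properties below.
\<close>

lemma smooth_coinduct:
  assumes "f \<in> S"
    and "\<And>f x. f \<in> S \<Longrightarrow> f field_differentiable (at x)"
    and "\<And>f. f \<in> S \<Longrightarrow> deriv f \<in> S"
  shows "smooth f"
proof -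
  have "(deriv ^^ k) f \<in> S" for k
    by (induction k) (use assms in auto)
  then show ?thesis
    using assms(2) by (auto simp: smooth_def)
qed

lemma smooth_differentiable: "smooth f \<Longrightarrow> f field_differentiable (at x)"
  unfolding smooth_def by (metis funpow_0)

lemma smooth_has_deriv: "smooth f \<Longrightarrow> (f has_field_derivative deriv f x) (at x)"
  by (simp add: DERIV_deriv_iff_field_differentiable smooth_differentiable)

lemma smooth_deriv: "smooth f \<Longrightarrow> smooth (deriv f)"
  unfolding smooth_def by (metis comp_apply funpow_Suc_right)

lemma smooth_continuous_on: "smooth f \<Longrightarrow> continuous_on A f"
  by (meson DERIV_isCont continuous_at_imp_continuous_on smooth_has_deriv)

lemma smooth_antiderivative:
  assumes "smooth f" and d: "\<And>x. (F has_field_derivative f x) (at x)"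
  shows "smooth F"
proof -
  have "deriv F = f"
    using d by (intro ext DERIV_imp_deriv)
  then have "((deriv ^^ k) F) field_differentiable (at x)" for k x
    by (cases k) (use assms in \<open>auto simp: funpow_Suc_right field_differentiable_def smooth_def
        simp del: funpow.simps\<close>)
  then show ?thesis by (simp add: smooth_def)
qed

lemma smooth_const: "smooth (\<lambda>x. c)"
  by (rule smooth_coinduct[where S = "range (\<lambda>c x. c)"])
    (auto simp: field_differentiable_const)

lemma smooth_affine:
  assumes "smooth f"
  shows "smooth (\<lambda>x. f (a * x + b))"
proof (rule smooth_coinduct[where S = "{\<lambda>x. c * g (a * x + b) |c g. smooth g}"])
  show "(\<lambda>x. f (a * x + b)) \<in> {\<lambda>x. c * g (a * x + b) |c g. smooth g}"
    using assms by (intro CollectI exI[of _ 1] exI[of _ f]) auto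
  have *: "((\<lambda>x. c * g (a * x + b)) has_field_derivative c * a * deriv g (a * x + b)) (at x)"
    if "smooth g" for c x and g :: "real \<Rightarrow> real"
  proof -
    have "((\<lambda>x. c * g (a * x + b)) has_field_derivative c * (deriv g (a * x + b) * a)) (at x)"
      by (intro DERIV_cmult DERIV_chain2[OF smooth_has_deriv[OF that]])
        (auto intro!: derivative_eq_intros)
    then show ?thesis by (simp add: ac_simps)
  qed
  show "h field_differentiable at x" if "h \<in> {\<lambda>x. c * g (a * x + b) |c g. smooth g}" for h x
    using that * unfolding field_differentiable_def by blast
  show "deriv h \<in> {\<lambda>x. c * g (a * x + b) |c g. smooth g}"
    if "h \<in> {\<lambda>x. c * g (a * x + b) |c g. smooth g}" for h
  proof -
    from that obtain c g where h: "h = (\<lambda>x. c * g (a * x + b))" and g: "smooth g"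
      unfolding mem_Collect_eq by (elim exE conjE) (rule that)
    have "deriv h = (\<lambda>x. (c * a) * deriv g (a * x + b))"
      unfolding h using *[OF g] by (intro ext DERIV_imp_deriv)
    then show ?thesis using smooth_deriv[OF g] by blast
  qed
qed

text \<open>
  Products of smooth functions alone are not closed under differentiation, but by the product rule
  their sums are; this makes \<open>smooth_coinduct\<close> applicable.
\<close>

inductive_set product_sums :: "(real \<Rightarrow> real) set" where
  product: "smooth f \<Longrightarrow> smooth g \<Longrightarrow> (\<lambda>x. f x * g x) \<in> product_sums"
| sum: "u \<in> product_sums \<Longrightarrow> v \<in> product_sums \<Longrightarrow> (\<lambda>x. u x + v x) \<in> product_sums"

lemma smooth_product_sums:
  assumes "f \<in> product_sums"
  shows "smooth f"
proof -
  have *: "\<exists>u' \<in> product_sums. \<forall>x. (u has_field_derivative u' x) (at x)"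
    if "u \<in> product_sums" for u
    using that
  proof induction
    case (product f g)
    have "((\<lambda>x. f x * g x) has_field_derivative deriv f x * g x + f x * deriv g x) (at x)" for x
      by (rule derivative_eq_intros smooth_has_deriv product refl | simp)+
    moreover have "(\<lambda>x. deriv f x * g x + f x * deriv g x) \<in> product_sums"
      using product by (intro product_sums.intros smooth_deriv)
    ultimately show ?case
      by (intro bexI[of _ "\<lambda>x. deriv f x * g x + f x * deriv g x"]) auto
  next
    case (sum u v)
    then obtain u' v' where u': "u' \<in> product_sums" "\<And>x. (u has_field_derivative u' x) (at x)"
      and v': "v' \<in> product_sums" "\<And>x. (v has_field_derivative v' x) (at x)" by blast
    show ?case
      by (rule bexI[of _ "\<lambda>x. u' x + v' x"])
        (use u' v' in \<open>auto intro: DERIV_add product_sums.sum\<close>)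
  qed
  show ?thesis
  proof (rule smooth_coinduct[OF assms])
    show "u field_differentiable at x" if "u \<in> product_sums" for u x
      using *[OF that] by (auto simp: field_differentiable_def)
    show "deriv u \<in> product_sums" if "u \<in> product_sums" for u
    proof -
      obtain u' where u': "u' \<in> product_sums" "\<And>x. (u has_field_derivative u' x) (at x)"
        using *[OF \<open>u \<in> product_sums\<close>] by blast
      have "deriv u = u'" using u'(2) by (intro ext DERIV_imp_deriv)
      with u' show ?thesis by simp
    qed
  qed
qed

lemma smooth_mult: "smooth f \<Longrightarrow> smooth g \<Longrightarrow> smooth (\<lambda>x. f x * g x)"
  by (rule smooth_product_sums[OF product_sums.product])

lemma smooth_add: "smooth f \<Longrightarrow> smooth g \<Longrightarrow> smooth (\<lambda>x. f x + g x)"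
proof -
  assume "smooth f" "smooth g"
  then have "(\<lambda>x. f x * 1 + g x * 1) \<in> product_sums"
    by (intro product_sums.intros smooth_const)
  then show ?thesis by (simp add: smooth_product_sums)
qed

lemma smooth_cmult: "smooth f \<Longrightarrow> smooth (\<lambda>x. c * f x)"
  by (intro smooth_mult smooth_const)

lemma smooth_diff: "smooth f \<Longrightarrow> smooth g \<Longrightarrow> smooth (\<lambda>x. f x - g x)"
  using smooth_add[OF _ smooth_cmult[of g "-1"], of f] by simp

lemma smooth_power: "smooth f \<Longrightarrow> smooth (\<lambda>x. f x ^ n)"
  by (induction n) (auto intro: smooth_const smooth_mult)

text \<open>
  All derivatives of the extension of \<open>exp (- 1/x)\<close> by zero to the left half-line have this
  form: each differentiation just changes the polynomial in \<open>1/x\<close>.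
\<close>

definition flat_poly_exp :: "real poly \<Rightarrow> real \<Rightarrow> real" where
  "flat_poly_exp p x = (if x > 0 then poly p (1 / x) * exp (- (1 / x)) else 0)"

lemma poly_times_exp_minus_tendsto_0: "((\<lambda>y. poly p y * exp (- y)) \<longlongrightarrow> (0::real)) at_top"
proof -
  have "((\<lambda>y::real. \<Sum>i\<le>degree p. coeff p i * (y ^ i / exp y)) \<longlongrightarrow> (\<Sum>i\<le>degree p. coeff p i * 0)) at_top"
    by (intro tendsto_intros tendsto_power_div_exp_0)
  moreover have "(\<Sum>i\<le>degree p. coeff p i * (y ^ i / exp y)) = poly p y * exp (- y)" for y
    by (simp add: poly_altdef sum_distrib_right exp_minus divide_inverse mult.assoc)
  ultimately show ?thesis by simp
qed

text \<open>
  At zero, where the two branches meet, the difference quotient from the right is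
  \<open>y p(y) exp (- y)\<close> at \<open>y = 1/h \<rightarrow> \<infinity>\<close>, and the exponential beats the polynomial.
\<close>

lemma flat_poly_exp_has_deriv:
  "(flat_poly_exp p has_field_derivative flat_poly_exp ([:0, 0, 1:] * (p - pderiv p)) x) (at x)"
proof -
  consider "x < 0" | "x = 0" | "x > 0" by linarith
  then show ?thesis
  proof cases
    case 1
    have "((\<lambda>x. 0) has_field_derivative 0) (at x)" by simp
    then have "(flat_poly_exp p has_field_derivative 0) (at x)"
      by (rule has_field_derivative_transform_within_open[of _ _ _ "{..<0}"])
        (use 1 in \<open>auto simp: flat_poly_exp_def\<close>)
    with 1 show ?thesis by (simp add: flat_poly_exp_def)
  next
    case 2
    have "((\<lambda>h. poly (pCons 0 p) (inverse h) * exp (- inverse h)) \<longlongrightarrow> (0::real)) (at_right 0)"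
      by (rule filterlim_compose[OF poly_times_exp_minus_tendsto_0 filterlim_inverse_at_top_right])
    then have "((\<lambda>h. flat_poly_exp p h / h) \<longlongrightarrow> 0) (at_right 0)"
      by (rule tendsto_cong[THEN iffD1, rotated])
        (auto simp: eventually_at_filter flat_poly_exp_def field_simps)
    moreover have "((\<lambda>h. flat_poly_exp p h / h) \<longlongrightarrow> 0) (at_left 0)"
      by (rule tendsto_eventually) (auto simp: eventually_at_filter flat_poly_exp_def)
    ultimately have "((\<lambda>h. flat_poly_exp p h / h) \<longlongrightarrow> 0) (at 0)"
      by (simp add: filterlim_at_split)
    with 2 show ?thesis by (simp add: DERIV_def flat_poly_exp_def)
  next
    case 3
    have inv: "((\<lambda>x. 1 / x) has_field_derivative (- ((1 / x) ^ 2))) (at x)"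
      using 3 by (auto intro!: derivative_eq_intros simp: power2_eq_square)
    have "((\<lambda>x. poly p (1 / x) * exp (- (1 / x))) has_field_derivative
        poly (pderiv p) (1 / x) * (- ((1 / x) ^ 2)) * exp (- (1 / x))
        + exp (- (1 / x)) * (- (- ((1 / x) ^ 2))) * poly p (1 / x)) (at x)"
      by (intro DERIV_mult DERIV_chain2[OF poly_DERIV inv] DERIV_chain2[OF DERIV_exp]
          DERIV_minus inv)
    also have "poly (pderiv p) (1 / x) * (- ((1 / x) ^ 2)) * exp (- (1 / x))
        + exp (- (1 / x)) * (- (- ((1 / x) ^ 2))) * poly p (1 / x)
        = poly ([:0, 0, 1:] * (p - pderiv p)) (1 / x) * exp (- (1 / x))"
      by (simp add: power2_eq_square algebra_simps)
    finally have "((\<lambda>x. poly p (1 / x) * exp (- (1 / x))) has_field_derivative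
        poly ([:0, 0, 1:] * (p - pderiv p)) (1 / x) * exp (- (1 / x))) (at x)" .
    then have "(flat_poly_exp p has_field_derivative
        poly ([:0, 0, 1:] * (p - pderiv p)) (1 / x) * exp (- (1 / x))) (at x)"
      by (rule has_field_derivative_transform_within_open[of _ _ _ "{0<..}"])
        (use 3 in \<open>auto simp: flat_poly_exp_def\<close>)
    with 3 show ?thesis by (simp add: flat_poly_exp_def)
  qed
qed

lemma smooth_flat_poly_exp: "smooth (flat_poly_exp p)"
proof (rule smooth_coinduct[where S = "range flat_poly_exp"])
  show "f field_differentiable at x" if "f \<in> range flat_poly_exp" for f x
    using that flat_poly_exp_has_deriv by (auto simp: field_differentiable_def)
  show "deriv f \<in> range flat_poly_exp" if "f \<in> range flat_poly_exp" for f
  proof -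
    obtain p where "f = flat_poly_exp p" using \<open>f \<in> _\<close> by auto
    then have "deriv f = flat_poly_exp ([:0, 0, 1:] * (p - pderiv p))"
      using flat_poly_exp_has_deriv by (intro ext DERIV_imp_deriv) auto
    then show ?thesis by simp
  qed
qed simp

lemma smooth_bump:
  "\<exists>\<beta>. smooth \<beta> \<and> (\<forall>x. 0 \<le> \<beta> x \<and> \<beta> x \<le> 1 \<and> (\<beta> x > 0 \<longleftrightarrow> x \<in> {a<..<b}))"
proof (intro exI conjI allI)
  let ?s = "flat_poly_exp 1"
  have s: "0 \<le> ?s x" "?s x \<le> 1" "?s x > 0 \<longleftrightarrow> x > 0" for x
    by (auto simp: flat_poly_exp_def)
  show "smooth (\<lambda>x. ?s (x - a) * ?s (b - x))"
    using smooth_mult[OF smooth_affine[OF smooth_flat_poly_exp, of 1 1 "-a"]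
        smooth_affine[OF smooth_flat_poly_exp, of 1 "-1" b]] by simp
  show "0 \<le> ?s (x - a) * ?s (b - x)" "?s (x - a) * ?s (b - x) \<le> 1" for x
    using s by (auto intro: mult_le_one)
  show "?s (x - a) * ?s (b - x) > 0 \<longleftrightarrow> x \<in> {a<..<b}" for x
    using s(1,3)[of "x - a"] s(1,3)[of "b - x"] by (auto simp: zero_less_mult_iff)
qed

lemma test_functions_iff:
  "\<psi> \<in> test_functions \<longleftrightarrow>
     smooth \<psi> \<and> (\<exists>a b. 0 < a \<and> b < pi \<and> (\<forall>x. x \<notin> {a..b} \<longrightarrow> \<psi> x = 0))"
  by (simp add: test_functions_def smooth_def)

lemma test_functions_deriv:
  assumes "\<psi> \<in> test_functions"
  shows "deriv \<psi> \<in> test_functions"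
proof -
  obtain a b where ab: "0 < a" "b < pi" "\<And>x. x \<notin> {a..b} \<Longrightarrow> \<psi> x = 0" and s: "smooth \<psi>"
    using assms by (auto simp: test_functions_iff)
  have "deriv \<psi> x = 0" if "x \<notin> {a..b}" for x
  proof -
    have "((\<lambda>x. 0) has_field_derivative 0) (at x)" by simp
    then have "(\<psi> has_field_derivative 0) (at x)"
      by (rule has_field_derivative_transform_within_open[of _ _ _ "- {a..b}"])
        (use that ab in auto)
    then show ?thesis by (rule DERIV_imp_deriv)
  qed
  with ab s show ?thesis
    unfolding test_functions_iff by (blast intro: smooth_deriv)
qed

text \<open>
  The approximation is \<open>1 - (1 - \<beta>)\<^sup>n\<close> for a bump \<open>\<beta>\<close> with values in \<open>[0,1]\<close> that is positive
  exactly on the interval. It is a polynomial in \<open>\<beta>\<close>, hence smooth, vanishes where \<open>\<beta>\<close> does, and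
  tends to 1 wherever \<open>\<beta> > 0\<close>; the bound by the indicator makes dominated convergence applicable.
\<close>

lemma test_functions_approximate_interval:
  assumes "0 < a" "b < pi"
  shows "\<exists>\<psi> :: nat \<Rightarrow> real \<Rightarrow> real. (\<forall>n. \<psi> n \<in> test_functions) \<and>
    (\<forall>n x. \<bar>\<psi> n x\<bar> \<le> indicator {a<..<b} x) \<and>
    (\<forall>x. (\<lambda>n. \<psi> n x) \<longlonglongrightarrow> indicator {a<..<b} x)"
proof -
  obtain \<beta> where \<beta>: "smooth \<beta>" "\<And>x. 0 \<le> \<beta> x" "\<And>x. \<beta> x \<le> 1" "\<And>x. \<beta> x > 0 \<longleftrightarrow> x \<in> {a<..<b}"
    using smooth_bump[of a b] by blast
  define \<psi> where "\<psi> n x = 1 - (1 - \<beta> x) ^ n" for n x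
  have \<beta>0: "\<beta> x = 0" if "x \<notin> {a<..<b}" for x
  proof -
    have "\<not> \<beta> x > 0" unfolding \<beta>(4) by (rule that)
    then show ?thesis using \<beta>(2)[of x] by linarith
  qed
  show ?thesis
  proof (intro exI[of _ \<psi>] conjI allI)
    show "\<psi> n \<in> test_functions" for n
      unfolding test_functions_iff
    proof
      show "smooth (\<psi> n)"
        unfolding \<psi>_def using \<beta>(1) by (intro smooth_diff smooth_power smooth_const)
      have "\<psi> n x = 0" if "x \<notin> {a..b}" for x
      proof -
        have "x \<notin> {a<..<b}" using that by auto
        then show ?thesis by (simp add: \<beta>0 \<psi>_def)
      qed
      then show "\<exists>a b. 0 < a \<and> b < pi \<and> (\<forall>x. x \<notin> {a..b} \<longrightarrow> \<psi> n x = 0)"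
        using assms by blast
    qed
    show "\<bar>\<psi> n x\<bar> \<le> indicator {a<..<b} x" for n x
      using \<beta>(2,3)[of x] \<beta>0[of x]
      by (auto simp: \<psi>_def indicator_def power_le_one)
    show "(\<lambda>n. \<psi> n x) \<longlonglongrightarrow> indicator {a<..<b} x" for x
    proof (cases "x \<in> {a<..<b}")
      case True
      then have "(\<lambda>n. (1 - \<beta> x) ^ n) \<longlonglongrightarrow> 0"
        using \<beta>(3,4)[of x] by (intro LIMSEQ_power_zero) auto
      from tendsto_diff[OF tendsto_const[of 1] this] True show ?thesis by (simp add: \<psi>_def)
    qed (simp add: \<psi>_def \<beta>0)
  qed
qed

section \<open>The fundamental lemma of the calculus of variations\<close>

abbreviation leb :: "real measure" where
  "leb \<equiv> lebesgue_on {0<..<pi}"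

text \<open>
  The sets over which \<open>D\<close> integrates to zero form a Dynkin system containing the half-lines,
  which generate the Borel sets and are stable under intersection. Completion only adds null sets.
\<close>

lemma AE_zero_if_integrals_lessThan_zero:
  fixes D :: "real \<Rightarrow> 'b::{second_countable_topology, banach}"
  assumes D: "integrable lebesgue D"
    and total: "integral\<^sup>L lebesgue D = 0"
    and less: "\<And>a. (LINT x|lebesgue. indicator {..<a} x *\<^sub>R D x) = 0"
  shows "AE x in lebesgue. D x = 0"
proof -
  have ind: "integrable lebesgue (\<lambda>x. indicator A x *\<^sub>R D x)" if "A \<in> sets lebesgue" for A
    using integrable_mult_indicator[OF that D] .
  have borel: "(LINT x|lebesgue. indicator A x *\<^sub>R D x) = 0" if "A \<in> sets borel" for A
  proof -
    have sigma: "sigma_sets UNIV (range lessThan) = sets (borel :: real measure)"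
      by (simp add: borel_Iio)
    have "{..<a} \<inter> {..<b} = {..<min a b}" for a b :: real by auto
    then have "Int_stable (range (lessThan :: real \<Rightarrow> _))"
      by (auto simp: Int_stable_def)
    moreover have "range lessThan \<subseteq> Pow (UNIV :: real set)" by simp
    moreover have "A \<in> sigma_sets UNIV (range lessThan)"
      using that sigma by simp
    ultimately show ?thesis
    proof (induction rule: sigma_sets_induct_disjoint)
      case (basic A)
      then show ?case using less by auto
    next
      case empty
      show ?case by simp
    next
      case (compl A)
      then have A: "A \<in> sets lebesgue"
        using sigma by (auto intro: sets_completionI_sets)
      have "(LINT x|lebesgue. indicator (UNIV - A) x *\<^sub>R D x)
          = (LINT x|lebesgue. D x - indicator A x *\<^sub>R D x)"
        by (intro Bochner_Integration.integral_cong) (auto simp: indicator_def)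
      also have "\<dots> = 0"
        using ind[OF A] D total compl by simp
      finally show ?case .
    next
      case (union A)
      then have A: "A i \<in> sets lebesgue" for i
        using sigma by (auto intro: sets_completionI_sets)
      have "set_lebesgue_integral lebesgue (\<Union>i. A i) D = (\<Sum>i. set_lebesgue_integral lebesgue (A i) D)"
        by (rule lebesgue_integral_countable_add)
          (use A union D in \<open>auto simp: disjoint_family_on_def set_integrable_def intro!: ind\<close>)
      then show ?case
        using union by (simp add: set_lebesgue_integral_def)
    qed
  qed
  show ?thesis
  proof (rule sigma_finite_measure.density_zero[OF _ D])
    show "sigma_finite_measure (lebesgue :: real measure)"
      proof
      obtain A :: "nat \<Rightarrow> real set" where "range A \<subseteq> sets lborel" "(\<Union>i. A i) = space lborel"
        "\<And>i. emeasure lborel (A i) \<noteq> \<infinity>"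
        using lborel.sigma_finite by blast
      then show "\<exists>A. countable A \<and> A \<subseteq> sets (lebesgue :: real measure) \<and>
          \<Union> A = space lebesgue \<and> (\<forall>a\<in>A. emeasure lebesgue a \<noteq> \<infinity>)"
        by (intro exI[of _ "range A"]) (auto simp: image_subset_iff)
    qed
    fix A :: "real set" assume "A \<in> sets lebesgue"
    then obtain S N N' where A: "A = S \<union> N" "N \<subseteq> N'" "N' \<in> null_sets lborel" "S \<in> sets lborel"
      by (rule sets_completionE)
    have "AE x in lebesgue. x \<notin> N'"
      using A(3) by (intro AE_not_in) (auto intro: null_sets_completionI)
    then have "AE x in lebesgue. indicator A x *\<^sub>R D x = indicator S x *\<^sub>R D x"
      by eventually_elim (use A in \<open>auto simp: indicator_def\<close>)
    then have "(LINT x|lebesgue. indicator A x *\<^sub>R D x) = (LINT x|lebesgue. indicator S x *\<^sub>R D x)"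
      using \<open>A \<in> sets lebesgue\<close> A(4)
      by (intro integral_cong_AE) (auto intro!: borel_measurable_integrable ind)
    then show "set_lebesgue_integral lebesgue A D = 0"
      using borel A(4) by (simp add: set_lebesgue_integral_def)
  qed
qed

lemma integral_leb:
  fixes f :: "real \<Rightarrow> 'b::{second_countable_topology, banach}"
  shows "integral\<^sup>L leb f = (LINT x|lebesgue. indicator {0<..<pi} x *\<^sub>R f x)"
  by (simp add: integral_restrict_space)

lemma integrable_leb:
  fixes f :: "real \<Rightarrow> 'b::{second_countable_topology, banach}"
  shows "integrable leb f \<longleftrightarrow> integrable lebesgue (\<lambda>x. indicator {0<..<pi} x *\<^sub>R f x)"
  by (simp add: integrable_restrict_space)

lemma integrable_lebesgue_on_subset:
  fixes f :: "real \<Rightarrow> 'b::{second_countable_topology, banach}"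
  assumes "integrable (lebesgue_on S) f" "T \<subseteq> S" "S \<in> sets lebesgue" "T \<in> sets lebesgue"
  shows "integrable (lebesgue_on T) f"
proof -
  have iff: "integrable (lebesgue_on A) f \<longleftrightarrow> set_integrable lebesgue A f" if "A \<in> sets lebesgue" for A
    using that by (simp add: integrable_restrict_space set_integrable_def)
  show ?thesis
    using assms set_integrable_subset by (metis iff)
qed

lemma integral_lebesgue_on_subset_mono:
  fixes f :: "real \<Rightarrow> real"
  assumes f: "integrable (lebesgue_on S) f" and "T \<subseteq> S" "S \<in> sets lebesgue" "T \<in> sets lebesgue"
    and nonneg: "\<And>x. x \<in> S \<Longrightarrow> 0 \<le> f x"
  shows "integral\<^sup>L (lebesgue_on T) f \<le> integral\<^sup>L (lebesgue_on S) f"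
proof -
  have *: "integral\<^sup>L (lebesgue_on A) f = (LINT x|lebesgue. indicator A x *\<^sub>R f x)"
    "integrable (lebesgue_on A) f \<longleftrightarrow> integrable lebesgue (\<lambda>x. indicator A x *\<^sub>R f x)"
    if "A \<in> sets lebesgue" for A
    using that by (simp_all add: integral_restrict_space integrable_restrict_space)
  have "integrable (lebesgue_on T) f"
    using assms by (intro integrable_lebesgue_on_subset[OF f])
  then show ?thesis
    using assms unfolding *(1)[OF assms(3)] *(1)[OF assms(4)] *(2)[OF assms(3)] *(2)[OF assms(4)]
    by (intro integral_mono) (auto simp: indicator_def)
qed

lemma AE_leb: "(AE x in leb. P x) \<longleftrightarrow> (AE x in lebesgue. x \<in> {0<..<pi} \<longrightarrow> P x)"
  by (simp add: AE_restrict_space_iff)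

lemma smooth_bounded:
  assumes "smooth \<psi>"
  shows "\<exists>B. \<forall>x\<in>{0..pi}. \<bar>\<psi> x\<bar> \<le> B"
proof -
  have "compact (\<psi> ` {0..pi})"
    using assms by (intro compact_continuous_image smooth_continuous_on) auto
  then show ?thesis
    by (auto dest!: compact_imp_bounded simp: bounded_iff)
qed

lemma smooth_measurable: "smooth \<psi> \<Longrightarrow> \<psi> \<in> borel_measurable leb"
  by (intro continuous_imp_measurable_on_sets_lebesgue smooth_continuous_on) auto

lemma ident_measurable_leb[measurable]: "(\<lambda>x. x) \<in> borel_measurable leb"
  by (intro continuous_imp_measurable_on_sets_lebesgue continuous_intros) auto

text \<open>
  On a compact interval a square integrable function is integrable, since \<open>t \<le> 1 + t\<^sup>2\<close>.
\<close>

lemma L2_loc_locally_integrable: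
  assumes "f \<in> L2_loc" "0 < a" "b < pi"
  shows "integrable leb (\<lambda>x. indicator {a..b} x *\<^sub>R f x)"
proof -
  have f[measurable]: "f \<in> borel_measurable leb"
    using assms by (simp add: L2_loc_def)
  have sub: "{a..b} \<subseteq> {0<..<pi}" using assms by auto
  then have i: "integrable (lebesgue_on {a..b}) (\<lambda>x. (cmod (f x))\<^sup>2)"
    using assms by (simp add: L2_loc_def)
  have ms: "{a..b} \<in> sets leb"
    using sub by (simp add: sets_restrict_space_iff)
  have eq: "{0<..<pi} \<inter> {a..b} = {a..b}" using sub by auto
  have *: "indicat_real {0<..<pi} x * indicat_real {a..b} x = indicat_real {a..b} x" for x
    using sub by (auto simp: indicator_def)
  have "integrable leb (\<lambda>x. indicator {a..b} x *\<^sub>R (1 + (cmod (f x))\<^sup>2))"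
  proof -
    have "integrable (lebesgue_on {a..b}) (\<lambda>x. 1 + (cmod (f x))\<^sup>2)"
      using i by (intro Bochner_Integration.integrable_add)
        (auto simp: integrable_restrict_space)
    then show ?thesis
      unfolding integrable_leb scaleR_scaleR * by (simp add: integrable_restrict_space)
  qed
  then show ?thesis
  proof (rule Bochner_Integration.integrable_bound)
    show "(\<lambda>x. indicator {a..b} x *\<^sub>R f x) \<in> borel_measurable leb"
      using ms by measurable
    have "t \<le> 1 + t\<^sup>2" for t :: real
      using zero_le_power2[of "t - 1/2"] by (simp add: power2_eq_square algebra_simps)
    then show "AE x in leb. cmod (indicator {a..b} x *\<^sub>R f x)
        \<le> norm (indicator {a..b} x *\<^sub>R (1 + (cmod (f x))\<^sup>2))"
      by (intro AE_I2) (auto simp: indicator_def abs_of_nonneg add_nonneg_nonneg)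
  qed
qed

lemma integrable_test_times_L2_loc:
  assumes "\<psi> \<in> test_functions" "f \<in> L2_loc"
  shows "integrable leb (\<lambda>x. \<psi> x *\<^sub>R f x)"
proof -
  obtain a b where ab: "0 < a" "b < pi" "\<And>x. x \<notin> {a..b} \<Longrightarrow> \<psi> x = 0" and s: "smooth \<psi>"
    using assms by (auto simp: test_functions_iff)
  obtain B where B: "\<And>x. x \<in> {0..pi} \<Longrightarrow> \<bar>\<psi> x\<bar> \<le> B"
    using smooth_bounded[OF s] by blast
  have f[measurable]: "f \<in> borel_measurable leb"
    using assms by (simp add: L2_loc_def)
  have [measurable]: "\<psi> \<in> borel_measurable leb" using smooth_measurable[OF s] .
  have "integrable leb (\<lambda>x. B *\<^sub>R (indicator {a..b} x *\<^sub>R f x))"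
    by (intro integrable_scaleR_right L2_loc_locally_integrable assms ab)
  then show ?thesis
  proof (rule Bochner_Integration.integrable_bound)
    show "(\<lambda>x. \<psi> x *\<^sub>R f x) \<in> borel_measurable leb" by measurable
    show "AE x in leb. cmod (\<psi> x *\<^sub>R f x) \<le> cmod (B *\<^sub>R (indicator {a..b} x *\<^sub>R f x))"
    proof (rule AE_I2)
      fix x assume "x \<in> space leb"
      then have "\<bar>\<psi> x\<bar> \<le> \<bar>B\<bar>" using B[of x] by (auto simp: space_restrict_space)
      then show "cmod (\<psi> x *\<^sub>R f x) \<le> cmod (B *\<^sub>R (indicator {a..b} x *\<^sub>R f x))"
        using ab(3)[of x] by (cases "x \<in> {a..b}") (auto intro: mult_right_mono)
    qed
  qed
qed

text \<open>
  The fundamental lemma of the calculus of variations. Test functions converge boundedly to the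
  indicators of intervals, so \<open>d\<close> integrates to zero over every interval with closure inside
  \<open>(0,\<pi>)\<close>; countably many of these intervals exhaust \<open>(0,\<pi>)\<close>.
\<close>

lemma AE_zero_if_annihilates_test_functions:
  assumes d: "d \<in> L2_loc"
    and zero: "\<And>\<psi>. \<psi> \<in> test_functions \<Longrightarrow> (LINT x|leb. \<psi> x *\<^sub>R d x) = 0"
  shows "AE x in leb. d x = 0"
proof -
  have [measurable]: "d \<in> borel_measurable leb"
    using d by (simp add: L2_loc_def)
  have interval: "(LINT x|leb. indicator {a<..<b} x *\<^sub>R d x) = 0" if ab: "0 < a" "b < pi" for a b
  proof -
    obtain \<psi> where \<psi>: "\<And>n. \<psi> n \<in> test_functions"
      "\<And>n x. \<bar>\<psi> n x\<bar> \<le> indicator {a<..<b} x"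
      "\<And>x. (\<lambda>n. \<psi> n x) \<longlonglongrightarrow> indicator {a<..<b} x"
      using test_functions_approximate_interval[OF ab] by blast
    have [measurable]: "\<psi> n \<in> borel_measurable leb" for n
      using \<psi>(1) by (auto simp: test_functions_iff intro: smooth_measurable)
    have [measurable]: "{a<..<b} \<in> sets leb"
      using ab by (simp add: sets_restrict_space_iff subset_iff)
    have "(\<lambda>n. LINT x|leb. \<psi> n x *\<^sub>R d x) \<longlonglongrightarrow> (LINT x|leb. indicator {a<..<b} x *\<^sub>R d x)"
    proof (rule integral_dominated_convergence[where w = "\<lambda>x. norm (indicator {a..b} x *\<^sub>R d x)"])
      show "integrable leb (\<lambda>x. norm (indicator {a..b} x *\<^sub>R d x))"
        by (intro integrable_norm L2_loc_locally_integrable d ab)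
      show "AE x in leb. cmod (\<psi> n x *\<^sub>R d x) \<le> norm (indicator {a..b} x *\<^sub>R d x)" for n
      proof (rule AE_I2)
        fix x
        have "\<bar>\<psi> n x\<bar> \<le> indicator {a..b} x"
          by (rule order_trans[OF \<psi>(2)]) (auto simp: indicator_def)
        then show "cmod (\<psi> n x *\<^sub>R d x) \<le> norm (indicator {a..b} x *\<^sub>R d x)"
          by (simp add: mult_right_mono)
      qed
      show "AE x in leb. (\<lambda>n. \<psi> n x *\<^sub>R d x) \<longlonglongrightarrow> indicator {a<..<b} x *\<^sub>R d x"
        by (intro AE_I2 tendsto_scaleR \<psi>(3) tendsto_const)
    qed measurable
    then show ?thesis
      using zero[OF \<psi>(1)] by (simp add: LIMSEQ_const_iff)
  qed
  have *: "AE x in lebesgue. indicator {a<..<b} x *\<^sub>R d x = 0" if ab: "0 < a" "b < pi" for a b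
  proof (rule AE_zero_if_integrals_lessThan_zero)
    have leb: "indicator {0<..<pi} x *\<^sub>R indicator {a<..<c} x *\<^sub>R d x = indicator {a<..<c} x *\<^sub>R d x"
      if "c \<le> b" for x c
      using ab that by (auto simp: indicator_def)
    have "{a<..<b} \<in> sets leb"
      using ab by (simp add: sets_restrict_space_iff subset_iff)
    from integrable_mult_indicator[OF this L2_loc_locally_integrable[OF d ab]]
    have "integrable leb (\<lambda>x. indicator {a<..<b} x *\<^sub>R d x)"
      by (rule Bochner_Integration.integrable_cong[THEN iffD1, rotated 2])
        (auto simp: indicator_def)
    then show "integrable lebesgue (\<lambda>x. indicator {a<..<b} x *\<^sub>R d x)"
      unfolding integrable_leb leb[OF order_refl] .
    have int: "(LINT x|lebesgue. indicator {a<..<c} x *\<^sub>R d x) = 0" if "c \<le> b" for c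
      using interval[of a c] ab that unfolding integral_leb leb[OF that] by simp
    from int[of b] show "(LINT x|lebesgue. indicator {a<..<b} x *\<^sub>R d x) = 0" by simp
    show "(LINT x|lebesgue. indicator {..<c} x *\<^sub>R indicator {a<..<b} x *\<^sub>R d x) = 0" for c
    proof -
      have "indicator {..<c} x *\<^sub>R indicator {a<..<b} x *\<^sub>R d x = indicator {a<..<min b c} x *\<^sub>R d x"
        for x by (auto simp: indicator_def)
      then show ?thesis using int[of "min b c"] by (simp only:)
    qed
  qed
  have "AE x in lebesgue. \<forall>n::nat. indicator {1 / (n + 1)<..<pi - 1 / (n + 1)} x *\<^sub>R d x = 0"
    unfolding AE_all_countable by (intro allI *) auto
  then show ?thesis
    unfolding AE_leb
  proof eventually_elim
    case (elim x)
    show ?case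
    proof
      assume "x \<in> {0<..<pi}"
      then have "0 < min x (pi - x)" by simp
      then obtain n :: nat where "inverse (real (Suc n)) < min x (pi - x)"
        using reals_Archimedean by blast
      then have "x \<in> {1 / (real n + 1)<..<pi - 1 / (real n + 1)}"
        by (auto simp: field_simps)
      with elim[rule_format, of n] show "d x = 0"
        by (simp only: indicator_simps scaleR_one)
    qed
  qed
qed

section \<open>Weak derivatives and primitives\<close>

lemma cmod_add_squared_le: "(cmod (a + b))\<^sup>2 \<le> 2 * (cmod a)\<^sup>2 + 2 * (cmod b)\<^sup>2"
proof -
  have "(cmod (a + b))\<^sup>2 \<le> (cmod a + cmod b)\<^sup>2"
    by (intro power_mono norm_triangle_ineq) simp
  also have "\<dots> \<le> 2 * (cmod a)\<^sup>2 + 2 * (cmod b)\<^sup>2"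
    using zero_le_power2[of "cmod a - cmod b"] by (simp add: power2_eq_square algebra_simps)
  finally show ?thesis .
qed

lemma L2_loc_add:
  assumes "f \<in> L2_loc" "g \<in> L2_loc"
  shows "(\<lambda>x. f x + g x) \<in> L2_loc"
proof -
  have [measurable]: "f \<in> borel_measurable leb" "g \<in> borel_measurable leb"
    using assms by (auto simp: L2_loc_def)
  have "integrable (lebesgue_on K) (\<lambda>x. (cmod (f x + g x))\<^sup>2)" if K: "compact K" "K \<subseteq> {0<..<pi}" for K
  proof -
    have m: "h \<in> borel_measurable (lebesgue_on K)" if "h \<in> borel_measurable leb" for h :: "real \<Rightarrow> complex"
      using measurable_restrict_mono[OF that K(2)] .
    have [measurable]: "f \<in> borel_measurable (lebesgue_on K)" "g \<in> borel_measurable (lebesgue_on K)"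
      by (auto intro: m)
    have "integrable (lebesgue_on K) (\<lambda>x. 2 * (cmod (f x))\<^sup>2 + 2 * (cmod (g x))\<^sup>2)"
      using assms K by (auto simp: L2_loc_def)
    then show ?thesis
      by (rule Bochner_Integration.integrable_bound) (auto intro!: AE_I2 cmod_add_squared_le)
  qed
  then show ?thesis by (simp add: L2_loc_def)
qed

lemma L2_loc_cmult: "f \<in> L2_loc \<Longrightarrow> (\<lambda>x. c * f x) \<in> L2_loc"
  by (auto simp: L2_loc_def norm_mult power_mult_distrib)

lemma L2_loc_bounded:
  assumes [measurable]: "f \<in> borel_measurable leb" and B: "\<And>x. x \<in> {0<..<pi} \<Longrightarrow> cmod (f x) \<le> B"
  shows "f \<in> L2_loc"
proof -
  have "integrable (lebesgue_on K) (\<lambda>x. (cmod (f x))\<^sup>2)" if K: "compact K" "K \<subseteq> {0<..<pi}" for K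
  proof (rule Bochner_Integration.integrable_bound[where f = "\<lambda>x. B\<^sup>2"])
    have [measurable]: "f \<in> borel_measurable (lebesgue_on K)"
      using measurable_restrict_mono[OF assms(1) K(2)] .
    show "(\<lambda>x. (cmod (f x))\<^sup>2) \<in> borel_measurable (lebesgue_on K)" by measurable
    interpret finite_measure "lebesgue_on K"
      using K(1) by (intro finite_measure_lebesgue_on lmeasurable_compact)
    show "integrable (lebesgue_on K) (\<lambda>x. B\<^sup>2)" by simp
    show "AE x in lebesgue_on K. norm ((cmod (f x))\<^sup>2) \<le> norm (B\<^sup>2)"
      using B K(2) by (intro AE_I2) (auto intro!: power_mono)
  qed
  then show ?thesis by (simp add: L2_loc_def)
qed

lemma has_weak_deriv_add:
  assumes "has_weak_deriv f f'" "has_weak_deriv g g'"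
  shows "has_weak_deriv (\<lambda>x. f x + g x) (\<lambda>x. f' x + g' x)"
  unfolding has_weak_deriv_def
proof (intro conjI ballI L2_loc_add)
  fix \<psi> assume \<psi>: "\<psi> \<in> test_functions"
  then have d\<psi>: "deriv \<psi> \<in> test_functions" by (rule test_functions_deriv)
  have L: "f \<in> L2_loc" "f' \<in> L2_loc" "g \<in> L2_loc" "g' \<in> L2_loc"
    using assms by (auto simp: has_weak_deriv_def)
  note int = integrable_test_times_L2_loc[OF \<psi>] integrable_test_times_L2_loc[OF d\<psi>]
  have "(LINT x|leb. deriv \<psi> x *\<^sub>R (f x + g x))
      = (LINT x|leb. deriv \<psi> x *\<^sub>R f x) + (LINT x|leb. deriv \<psi> x *\<^sub>R g x)"
    by (simp add: scaleR_add_right int L)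
  also have "\<dots> = - (LINT x|leb. \<psi> x *\<^sub>R f' x) - (LINT x|leb. \<psi> x *\<^sub>R g' x)"
    using assms \<psi> by (simp add: has_weak_deriv_def)
  also have "\<dots> = - (LINT x|leb. \<psi> x *\<^sub>R (f' x + g' x))"
    by (simp add: scaleR_add_right int L)
  finally show "(LINT x|leb. deriv \<psi> x *\<^sub>R (f x + g x)) = - (LINT x|leb. \<psi> x *\<^sub>R (f' x + g' x))" .
qed (use assms in \<open>auto simp: has_weak_deriv_def\<close>)

lemma has_weak_deriv_cmult:
  assumes "has_weak_deriv f f'"
  shows "has_weak_deriv (\<lambda>x. c * f x) (\<lambda>x. c * f' x)"
  using assms by (auto simp: has_weak_deriv_def L2_loc_cmult mult_scaleR_right[symmetric]
      simp del: mult_scaleR_right)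

lemma has_weak_deriv_diff:
  assumes "has_weak_deriv f f'" "has_weak_deriv g g'"
  shows "has_weak_deriv (\<lambda>x. f x - g x) (\<lambda>x. f' x - g' x)"
  using has_weak_deriv_add[OF assms(1) has_weak_deriv_cmult[OF assms(2), of "-1"]] by simp

lemma has_weak_deriv_unique:
  assumes "has_weak_deriv f g" "has_weak_deriv f h"
  shows "AE x in leb. g x = h x"
proof -
  have "has_weak_deriv (\<lambda>x. 0) (\<lambda>x. g x - h x)"
    using has_weak_deriv_diff[OF assms] by simp
  then have "AE x in leb. g x - h x = 0"
    by (intro AE_zero_if_annihilates_test_functions) (auto simp: has_weak_deriv_def)
  then show ?thesis by simp
qed

lemma has_weak_deriv_weak_deriv: "f \<in> H1_loc \<Longrightarrow> has_weak_deriv f (weak_deriv f)"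
  using someI_ex[of "has_weak_deriv f"] by (simp add: H1_loc_def weak_deriv_def)

lemma has_weak_deriv_cong_AE:
  assumes "has_weak_deriv f g" "F \<in> L2_loc" and ae: "AE x in leb. f x = F x"
  shows "has_weak_deriv F g"
proof -
  have "(LINT x|leb. deriv \<psi> x *\<^sub>R F x) = (LINT x|leb. deriv \<psi> x *\<^sub>R f x)"
    if "\<psi> \<in> test_functions" for \<psi>
  proof (rule integral_cong_AE)
    have "deriv \<psi> \<in> test_functions" using test_functions_deriv[OF that] .
    then show "(\<lambda>x. deriv \<psi> x *\<^sub>R F x) \<in> borel_measurable leb"
      "(\<lambda>x. deriv \<psi> x *\<^sub>R f x) \<in> borel_measurable leb"
      using assms by (auto simp: has_weak_deriv_def intro!: borel_measurable_integrable integrable_test_times_L2_loc)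
    show "AE x in leb. deriv \<psi> x *\<^sub>R F x = deriv \<psi> x *\<^sub>R f x"
      using ae by eventually_elim simp
  qed
  with assms show ?thesis by (simp add: has_weak_deriv_def)
qed

definition primitive :: "(real \<Rightarrow> complex) \<Rightarrow> real \<Rightarrow> complex" where
  "primitive g x = (LINT t|leb. indicator {..<x} t *\<^sub>R g t)"

lemma integral_indicator_lessThan_deriv:
  assumes \<psi>: "\<psi> \<in> test_functions" and t: "t \<in> {0<..<pi}"
  shows "(LINT x|leb. indicator {..<x} t * deriv \<psi> x) = - \<psi> t"
proof -
  have s: "smooth \<psi>" and "\<psi> pi = 0"
    using \<psi> by (auto simp: test_functions_iff)
  have ftc: "(deriv \<psi> has_integral (\<psi> pi - \<psi> t)) {t..pi}"
    using t smooth_has_deriv[OF s]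
    by (intro fundamental_theorem_of_calculus)
      (auto simp: has_real_derivative_iff_has_vector_derivative[symmetric] intro: DERIV_subset)
  have "(LINT x|leb. indicator {..<x} t * deriv \<psi> x)
      = (LINT x|lebesgue. indicator {0<..<pi} x *\<^sub>R (indicator {..<x} t * deriv \<psi> x))"
    by (rule integral_leb)
  also have "\<dots> = (LINT x|lebesgue. indicator {t<..<pi} x *\<^sub>R deriv \<psi> x)"
    using t by (intro Bochner_Integration.integral_cong) (auto simp: indicator_def)
  also have "\<dots> = (LINT x|lebesgue_on {t<..<pi}. deriv \<psi> x)"
    by (simp add: integral_restrict_space)
  also have "\<dots> = integral {t<..<pi} (deriv \<psi>)"
  proof (rule lebesgue_integral_eq_integral)
    have "integrable (lebesgue_on {t..pi}) (deriv \<psi>)"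
      using smooth_deriv[OF s] by (intro continuous_imp_integrable_real smooth_continuous_on) auto
    then show "integrable (lebesgue_on {t<..<pi}) (deriv \<psi>)"
      by (rule integrable_lebesgue_on_subset) auto
  qed simp
  also have "\<dots> = integral {t..pi} (deriv \<psi>)"
    using integral_open_interval_real[of t pi "deriv \<psi>"] by simp
  also have "\<dots> = - \<psi> t"
    using integral_unique[OF ftc] \<open>\<psi> pi = 0\<close> by simp
  finally show ?thesis .
qed

lemma finite_measure_leb: "finite_measure leb"
  by (intro finite_measure_lebesgue_on) simp

text \<open>
  Integration by parts for a primitive of a merely integrable function. Writing the primitive as
  an integral over \<open>t < x\<close> and exchanging the order of integration leaves, for fixed \<open>t\<close>, the
  integral of \<open>\<psi>'\<close> from \<open>t\<close> to \<open>\<pi>\<close>, which is \<open>- \<psi> t\<close>.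
\<close>

lemma integral_deriv_times_primitive:
  assumes \<psi>: "\<psi> \<in> test_functions" and g: "integrable leb g"
  shows "(LINT x|leb. deriv \<psi> x *\<^sub>R primitive g x) = - (LINT x|leb. \<psi> x *\<^sub>R g x)"
proof -
  interpret finite_measure leb by (rule finite_measure_leb)
  interpret P: pair_sigma_finite leb leb ..
  have [measurable]: "g \<in> borel_measurable leb" using g by simp
  have d\<psi>: "smooth (deriv \<psi>)"
    using \<psi> by (auto simp: test_functions_iff intro: smooth_deriv)
  then have [measurable]: "deriv \<psi> \<in> borel_measurable leb" by (rule smooth_measurable)
  obtain B where B: "\<And>x. x \<in> {0..pi} \<Longrightarrow> \<bar>deriv \<psi> x\<bar> \<le> B"
    using smooth_bounded[OF d\<psi>] by blast
  have [measurable]: "(\<lambda>(x, t). indicat_real {..<x} t) \<in> borel_measurable (leb \<Otimes>\<^sub>M leb)"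
  proof -
    have [measurable]: "fst \<in> borel_measurable (leb \<Otimes>\<^sub>M leb)" "snd \<in> borel_measurable (leb \<Otimes>\<^sub>M leb)"
      using measurable_compose[OF measurable_fst ident_measurable_leb]
        measurable_compose[OF measurable_snd ident_measurable_leb] by auto
    have "(\<lambda>p. if snd p < fst p then 1 else 0 :: real) \<in> borel_measurable (leb \<Otimes>\<^sub>M leb)"
      by measurable
    then show ?thesis
      by (simp add: indicator_def of_bool_def case_prod_beta')
  qed
  define F where "F = (\<lambda>x t. (indicat_real {..<x} t * deriv \<psi> x) *\<^sub>R g t)"
  have [measurable]: "case_prod F \<in> borel_measurable (leb \<Otimes>\<^sub>M leb)"
    unfolding F_def by measurable
  have "integrable (leb \<Otimes>\<^sub>M leb) (\<lambda>(x, t). B *\<^sub>R g t)"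
    by (rule P.Fubini_integrable) (use g in auto)
  then have int: "integrable (leb \<Otimes>\<^sub>M leb) (case_prod F)"
  proof (rule Bochner_Integration.integrable_bound)
    show "AE p in leb \<Otimes>\<^sub>M leb. cmod (case_prod F p) \<le> cmod (case p of (x, t) \<Rightarrow> B *\<^sub>R g t)"
    proof (rule AE_I2)
      fix p assume "p \<in> space (leb \<Otimes>\<^sub>M leb)"
      then obtain x t where p: "p = (x, t)" "x \<in> {0..pi}"
        by (auto simp: space_pair_measure space_restrict_space)
      have "\<bar>indicat_real {..<x} t * deriv \<psi> x\<bar> \<le> \<bar>B\<bar>"
        using B[OF p(2)] by (auto simp: indicator_def)
      then show "cmod (case_prod F p) \<le> cmod (case p of (x, t) \<Rightarrow> B *\<^sub>R g t)"
        by (simp add: p F_def mult_right_mono flip: abs_mult)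
    qed
  qed measurable
  have "(LINT x|leb. deriv \<psi> x *\<^sub>R primitive g x) = (LINT x|leb. LINT t|leb. F x t)"
    by (simp add: primitive_def F_def mult.commute flip: scaleR_scaleR)
  also have "\<dots> = (LINT t|leb. LINT x|leb. F x t)"
    by (rule P.Fubini_integral[OF int, symmetric])
  also have "\<dots> = (LINT t|leb. (- \<psi> t) *\<^sub>R g t)"
  proof (intro Bochner_Integration.integral_cong refl)
    fix t assume "t \<in> space leb"
    then have t: "t \<in> {0<..<pi}" by (simp add: space_restrict_space)
    have "integrable leb (\<lambda>x. indicator {..<x} t * deriv \<psi> x)"
    proof (rule integrable_const_bound[where B = B])
      have "(\<lambda>x. indicator {t<..} x * deriv \<psi> x) \<in> borel_measurable leb"
        by measurable
      then show "(\<lambda>x. indicator {..<x} t * deriv \<psi> x) \<in> borel_measurable leb"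
        by (simp add: indicator_def)
      show "AE x in leb. norm (indicator {..<x} t * deriv \<psi> x) \<le> B"
      proof (rule AE_I2)
        fix x assume "x \<in> space leb"
        then have "\<bar>deriv \<psi> x\<bar> \<le> B" using B by (simp add: space_restrict_space)
        then show "norm (indicator {..<x} t * deriv \<psi> x) \<le> B"
          using abs_ge_zero[of "deriv \<psi> x"] unfolding indicator_def by auto
      qed
    qed
    then show "(LINT x|leb. F x t) = (- \<psi> t) *\<^sub>R g t"
      unfolding F_def by (simp add: integral_indicator_lessThan_deriv[OF \<psi> t])
  qed
  finally show ?thesis by simp
qed

section \<open>Weakly differentiable functions as primitives\<close>

lemma test_functions_lincomb:
  assumes "\<phi> \<in> test_functions" "\<psi> \<in> test_functions"
  shows "(\<lambda>x. c * \<phi> x - d * \<psi> x) \<in> test_functions"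
proof -
  obtain a b where ab: "0 < a" "b < pi" "\<And>x. x \<notin> {a..b} \<Longrightarrow> \<phi> x = 0"
    using assms by (auto simp: test_functions_iff)
  obtain a' b' where ab': "0 < a'" "b' < pi" "\<And>x. x \<notin> {a'..b'} \<Longrightarrow> \<psi> x = 0"
    using assms by (auto simp: test_functions_iff)
  have "c * \<phi> x - d * \<psi> x = 0" if "x \<notin> {min a a'..max b b'}" for x
  proof -
    have "x \<notin> {a..b}" "x \<notin> {a'..b'}" using that by auto
    then show ?thesis using ab(3) ab'(3) by simp
  qed
  moreover have "0 < min a a'" "max b b' < pi" using ab ab' by auto
  moreover have "smooth (\<lambda>x. c * \<phi> x - d * \<psi> x)"
    using assms by (intro smooth_diff smooth_cmult) (auto simp: test_functions_iff)
  ultimately show ?thesis unfolding test_functions_iff by blast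
qed

lemma integrable_test_function: "\<psi> \<in> test_functions \<Longrightarrow> integrable leb \<psi>"
proof -
  assume \<psi>: "\<psi> \<in> test_functions"
  have "(\<lambda>x. 1) \<in> L2_loc" by (rule L2_loc_bounded[where B = 1]) auto
  from integrable_test_times_L2_loc[OF \<psi> this]
  have "integrable leb (\<lambda>x. complex_of_real (\<psi> x))" by (simp add: scaleR_conv_of_real)
  from integrable_Re[OF this] show ?thesis by simp
qed

text \<open>
  The condition on the integral is what makes the antiderivative that vanishes on the left of the
  support vanish on its right as well.
\<close>

lemma test_function_antiderivative:
  assumes \<phi>: "\<phi> \<in> test_functions" and "integral\<^sup>L leb \<phi> = 0"
  shows "\<exists>\<psi> \<in> test_functions. deriv \<psi> = \<phi>"
proof -
  obtain a b where ab: "0 < a" "b < pi" "\<And>x. x \<notin> {a..b} \<Longrightarrow> \<phi> x = 0" and s: "smooth \<phi>"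
    using assms by (auto simp: test_functions_iff)
  define \<psi> where "\<psi> x = integral {0..x} \<phi>" for x
  have left: "\<psi> x = 0" if "x < a" for x
  proof -
    have "integral {0..x} \<phi> = integral {0..x} (\<lambda>x. 0)"
      by (rule Henstock_Kurzweil_Integration.integral_cong) (use that ab in auto)
    then show ?thesis by (simp add: \<psi>_def)
  qed
  have right: "\<psi> x = 0" if "b < x" for x
  proof -
    have "\<psi> x = integral UNIV (\<lambda>y. if y \<in> {0..x} then \<phi> y else 0)"
      unfolding \<psi>_def by (rule integral_restrict_UNIV[symmetric])
    also have "(\<lambda>y. if y \<in> {0..x} then \<phi> y else 0) = (\<lambda>y. if y \<in> {0<..<pi} then \<phi> y else 0)"
      using ab that by (force simp: fun_eq_iff)
    also have "integral UNIV \<dots> = integral {0<..<pi} \<phi>"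
      by (rule integral_restrict_UNIV)
    also have "\<dots> = integral\<^sup>L leb \<phi>"
      by (intro lebesgue_integral_eq_integral[symmetric] integrable_test_function \<phi>) simp
    finally show ?thesis using assms by simp
  qed
  have d: "(\<psi> has_field_derivative \<phi> x) (at x)" for x
  proof (cases "x < a")
    case True
    have "((\<lambda>x. 0) has_field_derivative 0) (at x)" by simp
    then have "(\<psi> has_field_derivative 0) (at x)"
      by (rule has_field_derivative_transform_within_open[of _ _ _ "{..<a}"])
        (use True left in auto)
    with True ab(3) show ?thesis by simp
  next
    case False
    then have x: "x \<in> {0<..<x+1}" using ab by auto
    have "(\<psi> has_real_derivative \<phi> x) (at x within {0..x+1})"
      unfolding \<psi>_def
      by (rule integral_has_real_derivative) (use x s in \<open>auto intro: smooth_continuous_on\<close>)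
    then have "(\<psi> has_real_derivative \<phi> x) (at x within {0<..<x+1})"
      by (rule DERIV_subset) auto
    then show ?thesis by (simp only: at_within_open[OF x open_greaterThanLessThan])
  qed
  have "\<psi> x = 0" if "x \<notin> {a..b}" for x
    using left[of x] right[of x] that by auto
  then have "\<psi> \<in> test_functions"
    unfolding test_functions_iff using smooth_antiderivative[OF s d] ab(1,2) by blast
  moreover have "deriv \<psi> = \<phi>" using d by (intro ext DERIV_imp_deriv)
  ultimately show ?thesis by blast
qed

lemma test_function_nonzero_integral: "\<exists>\<beta> \<in> test_functions. integral\<^sup>L leb \<beta> \<noteq> 0"
proof -
  obtain \<beta> where \<beta>: "smooth \<beta>" "\<And>x. 0 \<le> \<beta> x" "\<And>x. \<beta> x > 0 \<longleftrightarrow> x \<in> {1<..<2}"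
    using smooth_bump[of 1 2] by blast
  have "\<beta> x = 0" if "x \<notin> {1..2}" for x
  proof -
    have "\<not> \<beta> x > 0" unfolding \<beta>(3) using that by auto
    then show ?thesis using \<beta>(2)[of x] by linarith
  qed
  moreover have "2 < pi" using pi_gt3 by simp
  ultimately have t: "\<beta> \<in> test_functions"
    unfolding test_functions_iff using \<beta>(1) zero_less_one by blast
  have "integral\<^sup>L leb \<beta> \<noteq> 0"
  proof
    assume "integral\<^sup>L leb \<beta> = 0"
    then have "AE x in leb. \<beta> x = 0"
      using \<beta>(2) integrable_test_function[OF t] by (simp add: integral_nonneg_eq_0_iff_AE)
    then have "AE x in lebesgue. x \<notin> {1<..<2::real}"
      unfolding AE_leb
    proof eventually_elim
      case (elim x)
      then show ?case using \<beta>(3)[of x] pi_gt3 by auto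
    qed
    then have "{1<..<2} \<in> null_sets (lebesgue :: real measure)"
      by (simp add: AE_iff_null_sets)
    then show False by (auto simp: null_sets_def)
  qed
  with t show ?thesis by blast
qed

text \<open>
  The lemma of du Bois-Reymond. Fix a test function \<open>\<beta>\<close> of nonzero integral. For any test function
  \<open>\<alpha>\<close>, the combination \<open>(\<integral>\<beta>) \<alpha> - (\<integral>\<alpha>) \<beta>\<close> has integral zero, so it is the derivative of a test
  function and is annihilated by \<open>h\<close>. Hence \<open>\<integral>\<alpha>h = c \<integral>\<alpha>\<close> with \<open>c = \<integral>\<beta>h / \<integral>\<beta>\<close>, and \<open>h - c\<close>
  annihilates all test functions.
\<close>

lemma AE_constant_if_weak_deriv_zero:
  assumes "has_weak_deriv h (\<lambda>x. 0)"
  shows "\<exists>c. AE x in leb. h x = c"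
proof -
  have h: "h \<in> L2_loc" using assms by (simp add: has_weak_deriv_def)
  obtain \<beta> where \<beta>: "\<beta> \<in> test_functions" "integral\<^sup>L leb \<beta> \<noteq> 0"
    using test_function_nonzero_integral by blast
  define c where "c = (LINT x|leb. \<beta> x *\<^sub>R h x) /\<^sub>R integral\<^sup>L leb \<beta>"
  have const: "(\<lambda>x. - c) \<in> L2_loc" by (rule L2_loc_bounded[where B = "cmod c"]) auto
  have "AE x in leb. h x + - c = 0"
  proof (rule AE_zero_if_annihilates_test_functions)
    show "(\<lambda>x. h x + - c) \<in> L2_loc" by (intro L2_loc_add h const)
    fix \<alpha> assume \<alpha>: "\<alpha> \<in> test_functions"
    define \<phi> where "\<phi> x = integral\<^sup>L leb \<beta> * \<alpha> x - integral\<^sup>L leb \<alpha> * \<beta> x" for x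
    note ints = integrable_test_function[OF \<alpha>] integrable_test_function[OF \<beta>(1)]
      integrable_test_times_L2_loc[OF \<alpha> h] integrable_test_times_L2_loc[OF \<beta>(1) h]
    have "\<phi> \<in> test_functions" "integral\<^sup>L leb \<phi> = 0"
      unfolding \<phi>_def using test_functions_lincomb[OF \<alpha> \<beta>(1)] ints by simp_all
    then obtain \<psi> where "\<psi> \<in> test_functions" "deriv \<psi> = \<phi>"
      using test_function_antiderivative by blast
    then have "(LINT x|leb. \<phi> x *\<^sub>R h x) = 0"
      using assms by (auto simp: has_weak_deriv_def)
    also have "(LINT x|leb. \<phi> x *\<^sub>R h x)
        = (LINT x|leb. integral\<^sup>L leb \<beta> *\<^sub>R (\<alpha> x *\<^sub>R h x) - integral\<^sup>L leb \<alpha> *\<^sub>R (\<beta> x *\<^sub>R h x))"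
      by (simp add: \<phi>_def scaleR_diff_left)
    also have "\<dots> = integral\<^sup>L leb \<beta> *\<^sub>R (LINT x|leb. \<alpha> x *\<^sub>R h x)
        - integral\<^sup>L leb \<alpha> *\<^sub>R (LINT x|leb. \<beta> x *\<^sub>R h x)"
      by (subst Bochner_Integration.integral_diff) (use ints in \<open>simp_all del: scaleR_scaleR\<close>)
    finally have "integral\<^sup>L leb \<beta> *\<^sub>R (LINT x|leb. \<alpha> x *\<^sub>R h x)
        = integral\<^sup>L leb \<alpha> *\<^sub>R (LINT x|leb. \<beta> x *\<^sub>R h x)" by simp
    moreover have "(LINT x|leb. \<beta> x *\<^sub>R h x) = integral\<^sup>L leb \<beta> *\<^sub>R c"
      using \<beta>(2) by (simp add: c_def)
    ultimately have "integral\<^sup>L leb \<beta> *\<^sub>R (LINT x|leb. \<alpha> x *\<^sub>R h x)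
        = integral\<^sup>L leb \<beta> *\<^sub>R (integral\<^sup>L leb \<alpha> *\<^sub>R c)"
      by (simp add: mult.commute)
    then have "(LINT x|leb. \<alpha> x *\<^sub>R h x) = integral\<^sup>L leb \<alpha> *\<^sub>R c"
      using \<beta>(2) by (simp only: scaleR_cancel_left simp_thms)
    moreover have "(LINT x|leb. \<alpha> x *\<^sub>R (h x + - c))
        = (LINT x|leb. \<alpha> x *\<^sub>R h x) + (LINT x|leb. \<alpha> x *\<^sub>R - c)"
      unfolding scaleR_add_right
      by (intro Bochner_Integration.integral_add ints integrable_test_times_L2_loc[OF \<alpha> const])
    ultimately show "(LINT x|leb. \<alpha> x *\<^sub>R (h x + - c)) = 0"
      using ints by simp
  qed
  then have "AE x in leb. h x = c"
    by eventually_elim simp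
  then show ?thesis by (rule exI[of _ c])
qed

lemma primitive_eq_integral:
  assumes g: "integrable leb g" and x: "x \<in> {0..pi}"
  shows "primitive g x = integral {0..x} g"
proof -
  have i: "integrable (lebesgue_on {0<..<x}) g"
  proof (rule integrable_lebesgue_on_subset[OF g])
    show "{0<..<x} \<subseteq> {0<..<pi}" by (rule subsetI) (use x in simp)
  qed simp_all
  have "primitive g x = (LINT t|lebesgue. indicator {0<..<pi} t *\<^sub>R (indicator {..<x} t *\<^sub>R g t))"
    unfolding primitive_def by (rule integral_leb)
  also have "\<dots> = (LINT t|lebesgue. indicator {0<..<x} t *\<^sub>R g t)"
    using x by (intro Bochner_Integration.integral_cong) (auto simp: indicator_def)
  also have "\<dots> = integral\<^sup>L (lebesgue_on {0<..<x}) g"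
    by (simp add: integral_restrict_space)
  also have "\<dots> = integral {0<..<x} g"
    using i by (rule lebesgue_integral_eq_integral) simp
  also have "\<dots> = integral {0..x} g"
    by (rule integral_open_interval_real[symmetric])
  finally show ?thesis .
qed

lemma continuous_on_primitive:
  assumes g: "integrable leb g"
  shows "continuous_on {0..pi} (primitive g)"
proof -
  have "g integrable_on {0<..<pi}"
    using g by (rule integrable_on_lebesgue_on) simp
  then have "g integrable_on {0..pi}"
    by (simp add: integrable_on_open_interval_real)
  from indefinite_integral_continuous_1[OF this] show ?thesis
    by (rule continuous_on_cong[THEN iffD1, rotated 2])
      (auto simp: primitive_eq_integral[OF g])
qed

lemma continuous_on_L2_loc:
  assumes F: "continuous_on {0..pi} F"
  shows "F \<in> L2_loc"
proof -
  have "bounded (F ` {0..pi})"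
    using F by (intro compact_imp_bounded compact_continuous_image) auto
  then obtain B where B: "\<forall>x\<in>{0..pi}. cmod (F x) \<le> B"
    by (auto simp: bounded_iff)
  show ?thesis
  proof (rule L2_loc_bounded)
    show "F \<in> borel_measurable leb"
      using F by (intro continuous_imp_measurable_on_sets_lebesgue continuous_on_subset[OF F]) auto
    show "cmod (F x) \<le> B" if "x \<in> {0<..<pi}" for x using B that by simp
  qed
qed

lemma has_weak_deriv_primitive:
  assumes "integrable leb g" "g \<in> L2_loc"
  shows "has_weak_deriv (primitive g) g"
  using assms continuous_on_L2_loc[OF continuous_on_primitive[OF assms(1)]]
    integral_deriv_times_primitive[OF _ assms(1)]
  by (simp add: has_weak_deriv_def)

text \<open>
  The primitive of \<open>g\<close> has weak derivative \<open>g\<close> as well, so it differs from \<open>f\<close> by a function with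
  weak derivative zero.
\<close>

lemma AE_eq_constant_plus_primitive:
  assumes f: "has_weak_deriv f g" and g: "integrable leb g"
  shows "\<exists>c. AE x in leb. f x = c + primitive g x"
proof -
  have "has_weak_deriv (primitive g) g"
    using f g by (intro has_weak_deriv_primitive) (auto simp: has_weak_deriv_def)
  from has_weak_deriv_diff[OF f this]
  have "has_weak_deriv (\<lambda>x. f x - primitive g x) (\<lambda>x. 0)" by simp
  from AE_constant_if_weak_deriv_zero[OF this]
  obtain c where "AE x in leb. f x - primitive g x = c" ..
  then have "AE x in leb. f x = c + primitive g x"
    by eventually_elim (simp add: algebra_simps)
  then show ?thesis by (rule exI[of _ c])
qed

section \<open>The weight near an endpoint\<close>

lemma cos_ge_half: "0 \<le> u \<Longrightarrow> u \<le> pi / 3 \<Longrightarrow> cos u \<ge> (1 / 2 :: real)"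
  using cos_monotone_0_pi_le[of u "pi / 3"] by (simp add: cos_60)

text \<open>
  Jordan's inequality with a cruder constant, which is all that the order of vanishing of the
  weight requires. Halving the angle brings it into the range where the cosine is at least one
  half; there \<open>sin u - u/2\<close> increases, and \<open>sin t = 2 sin u cos u\<close>.
\<close>

lemma sin_ge_quarter:
  fixes t :: real
  assumes "0 \<le> t" "t \<le> pi / 2"
  shows "t / 4 \<le> sin t"
proof -
  define u where "u = t / 2"
  have u: "0 \<le> u" "u \<le> pi / 3" using assms by (auto simp: u_def)
  have "sin 0 - 0 / 2 \<le> sin u - u / 2"
  proof (rule DERIV_nonneg_imp_nondecreasing[OF u(1)])
    fix x assume "0 \<le> x" "x \<le> u"
    then have "cos x - 1 / 2 \<ge> 0" using cos_ge_half[of x] u by simp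
    moreover have "((\<lambda>x. sin x - x / 2) has_real_derivative cos x - 1 / 2) (at x)"
      by (auto intro!: derivative_eq_intros)
    ultimately show "\<exists>y. ((\<lambda>x. sin x - x / 2) has_real_derivative y) (at x) \<and> 0 \<le> y" by blast
  qed
  then have "u / 2 \<le> sin u" by simp
  then have "u / 2 * (1 / 2) \<le> sin u * cos u"
    using u cos_ge_half[of u] by (intro mult_mono) auto
  moreover have "sin t = 2 * (sin u * cos u)"
    using sin_double[of u] by (simp add: u_def)
  ultimately show ?thesis by (simp add: u_def)
qed

lemma weight_pos: "x \<in> {0<..<pi} \<Longrightarrow> 0 < weight x"
  by (simp add: weight_def sin_gt_zero)

lemma weight_ge_sqrt_dist:
  assumes e: "e \<in> {0, pi}" and x: "x \<in> {0<..<pi}" "\<bar>x - e\<bar> \<le> pi / 2"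
  shows "sqrt \<bar>x - e\<bar> / 2 \<le> weight x"
proof -
  have "sin \<bar>x - e\<bar> = sin x" using e x by auto
  then have "\<bar>x - e\<bar> / 4 \<le> sin x"
    using sin_ge_quarter[of "\<bar>x - e\<bar>"] x by simp
  then have "sqrt (\<bar>x - e\<bar> / 4) \<le> weight x"
    unfolding weight_def by (rule real_sqrt_le_mono)
  then show ?thesis by (simp add: real_sqrt_divide)
qed

lemma weight_measurable[measurable]: "weight \<in> borel_measurable leb"
  unfolding weight_def
  by (intro continuous_imp_measurable_on_sets_lebesgue continuous_intros) auto

text \<open>
  The singularity at \<open>e\<close> is harmless for the fundamental theorem of calculus: the antiderivative
  is continuous there. Integrating over both sides of \<open>e\<close> treats the two endpoints of \<open>(0,\<pi>)\<close> alike.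
\<close>

lemma has_integral_inverse_sqrt_dist:
  fixes e s :: real
  assumes "0 \<le> s"
  shows "((\<lambda>x. 1 / sqrt \<bar>x - e\<bar>) has_integral 4 * sqrt s) {e - s..e + s}"
proof -
  have "((\<lambda>x. 1 / sqrt \<bar>x - e\<bar>) has_integral
      sgn (e + s - e) * (2 * sqrt \<bar>e + s - e\<bar>) - sgn (e - s - e) * (2 * sqrt \<bar>e - s - e\<bar>)) {e - s..e + s}"
  proof (rule fundamental_theorem_of_calculus_interior_strong[where S = "{e}"])
    show "continuous_on {e - s..e + s} (\<lambda>x. sgn (x - e) * (2 * sqrt \<bar>x - e\<bar>))"
    proof -
      have "continuous_on {e - s..e + s} (\<lambda>x. 2 * root 2 (x - e))"
        by (intro continuous_intros)
      \<comment> \<open>The odd extension of the square root is continuous, and \<open>root 2\<close> is exactly that extension.\<close>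
      moreover have "2 * root 2 (x - e) = sgn (x - e) * (2 * sqrt \<bar>x - e\<bar>)" for x
        by (cases "x \<le> e") (auto simp: sqrt_def sgn_if real_root_minus[symmetric] simp del: real_root_minus)
      ultimately show ?thesis by simp
    qed
    fix x assume "x \<in> {e - s<..<e + s} - {e}"
    then consider "x < e" | "x > e" by fastforce
    then show "((\<lambda>x. sgn (x - e) * (2 * sqrt \<bar>x - e\<bar>)) has_vector_derivative 1 / sqrt \<bar>x - e\<bar>) (at x)"
    proof cases
      case 1
      have "((\<lambda>x. - (2 * sqrt (e - x))) has_real_derivative 1 / sqrt \<bar>x - e\<bar>) (at x)"
        using 1 by (auto intro!: derivative_eq_intros simp: field_simps)
      then have "((\<lambda>x. sgn (x - e) * (2 * sqrt \<bar>x - e\<bar>)) has_real_derivative 1 / sqrt \<bar>x - e\<bar>) (at x)"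
        by (rule has_field_derivative_transform_within_open[of _ _ _ "{..<e}"]) (use 1 in auto)
      then show ?thesis by (simp add: has_real_derivative_iff_has_vector_derivative)
    next
      case 2
      have "((\<lambda>x. 2 * sqrt (x - e)) has_real_derivative 1 / sqrt \<bar>x - e\<bar>) (at x)"
        using 2 by (auto intro!: derivative_eq_intros simp: field_simps)
      then have "((\<lambda>x. sgn (x - e) * (2 * sqrt \<bar>x - e\<bar>)) has_real_derivative 1 / sqrt \<bar>x - e\<bar>) (at x)"
        by (rule has_field_derivative_transform_within_open[of _ _ _ "{e<..}"]) (use 2 in auto)
      then show ?thesis by (simp add: has_real_derivative_iff_has_vector_derivative)
    qed
  qed (use assms in auto)
  then show ?thesis using assms by (simp add: sgn_if split: if_splits)
qed

lemma inverse_sqrt_dist_lebesgue: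
  fixes e s :: real
  assumes "0 \<le> s"
  shows "integrable (lebesgue_on {e - s..e + s}) (\<lambda>x. 1 / sqrt \<bar>x - e\<bar>)"
    and "(LINT x|lebesgue_on {e - s..e + s}. 1 / sqrt \<bar>x - e\<bar>) = 4 * sqrt s"
proof -
  note h = has_integral_inverse_sqrt_dist[OF assms, of e]
  then have "(\<lambda>x. 1 / sqrt \<bar>x - e\<bar>) absolutely_integrable_on {e - s..e + s}"
    by (intro nonnegative_absolutely_integrable_1) auto
  then show i: "integrable (lebesgue_on {e - s..e + s}) (\<lambda>x. 1 / sqrt \<bar>x - e\<bar>)"
    by (simp add: integrable_restrict_space set_integrable_def)
  show "(LINT x|lebesgue_on {e - s..e + s}. 1 / sqrt \<bar>x - e\<bar>) = 4 * sqrt s"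
    using lebesgue_integral_eq_integral[OF i] integral_unique[OF h] by simp
qed

text \<open>
  Young's inequality \<open>2u \<le> l w u\<^sup>2 + 1/(l w)\<close> for all \<open>l > 0\<close> gives integrability of \<open>u\<close> (with
  \<open>l = 1\<close>) and, after integration and the optimal choice of \<open>l\<close>, the product bound.
\<close>

lemma weighted_Cauchy_Schwarz:
  fixes u w :: "'a \<Rightarrow> real"
  assumes [measurable]: "u \<in> borel_measurable M" and u: "\<And>x. x \<in> space M \<Longrightarrow> 0 \<le> u x"
    and w: "\<And>x. x \<in> space M \<Longrightarrow> 0 < w x"
    and A: "integrable M (\<lambda>x. w x * (u x)\<^sup>2)" and B: "integrable M (\<lambda>x. 1 / w x)"
  shows "integrable M u"
    and "(integral\<^sup>L M u)\<^sup>2 \<le> (LINT x|M. w x * (u x)\<^sup>2) * (LINT x|M. 1 / w x)"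
proof -
  have young: "2 * u x \<le> l * (w x * (u x)\<^sup>2) + (1 / w x) / l" if "x \<in> space M" "0 < l" for x l
  proof -
    have "0 \<le> (l * w x * u x - 1)\<^sup>2 / (l * w x)"
      using w[OF that(1)] that(2) by simp
    also have "\<dots> = l * (w x * (u x)\<^sup>2) + (1 / w x) / l - 2 * u x"
      using w[OF that(1)] that(2) by (simp add: field_simps power2_eq_square)
    finally show ?thesis by simp
  qed
  show U: "integrable M u"
  proof (rule Bochner_Integration.integrable_bound[OF Bochner_Integration.integrable_add[OF A B]])
    show "AE x in M. norm (u x) \<le> norm (w x * (u x)\<^sup>2 + 1 / w x)"
    proof (rule AE_I2)
      fix x assume x: "x \<in> space M"
      show "norm (u x) \<le> norm (w x * (u x)\<^sup>2 + 1 / w x)"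
        using young[OF x zero_less_one] u[OF x] by simp
    qed
  qed simp
  define P where "P = integral\<^sup>L M u"
  define a where "a = (LINT x|M. w x * (u x)\<^sup>2)"
  define b where "b = (LINT x|M. 1 / w x)"
  have P: "0 \<le> P" unfolding P_def using u by (intro integral_nonneg_AE AE_I2)
  have a: "0 \<le> a" unfolding a_def using w by (intro integral_nonneg_AE AE_I2) (simp add: less_imp_le)
  have b: "0 \<le> b" unfolding b_def using w by (intro integral_nonneg_AE AE_I2) (simp add: less_imp_le)
  have main: "2 * P \<le> l * a + b / l" if "0 < l" for l
  proof -
    note lA = integrable_mult_right[OF A, of l] and Bl = integrable_divide[OF B, of l]
    have "(LINT x|M. 2 * u x) \<le> (LINT x|M. l * (w x * (u x)\<^sup>2) + (1 / w x) / l)"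
      by (rule integral_mono[OF integrable_mult_right[OF U] Bochner_Integration.integrable_add[OF lA Bl]
            young[OF _ that]])
    then show ?thesis
      unfolding Bochner_Integration.integral_add[OF lA Bl] integral_mult_right_zero
        integral_divide_zero P_def a_def b_def .
  qed
  have "P\<^sup>2 \<le> a * b"
  proof (cases "P = 0 \<or> a = 0")
    case True
    have "P = 0"
    proof (rule ccontr)
      assume "P \<noteq> 0"
      with True P have *: "a = 0" "0 < P" by auto
      \<comment> \<open>Any \<open>l\<close> larger than \<open>b / P\<close> gives a contradiction; the summand 1 covers \<open>b = 0\<close>.\<close>
      have "2 * P \<le> b / ((b + 1) / P)" using main[of "(b + 1) / P"] * b by simp
      also have "\<dots> \<le> P" using * b by (simp add: field_simps)
      finally show False using * by simp
    qed
    then show ?thesis using a b by simp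
  next
    case False
    then have "2 * P \<le> P + b / (P / a)" using main[of "P / a"] P a by simp
    then show ?thesis using False P a by (simp add: field_simps power2_eq_square)
  qed
  then show "(integral\<^sup>L M u)\<^sup>2 \<le> (LINT x|M. w x * (u x)\<^sup>2) * (LINT x|M. 1 / w x)"
    by (simp add: P_def a_def b_def)
qed

definition near :: "real \<Rightarrow> real \<Rightarrow> real set" where
  "near e s = {0<..<pi} \<inter> {e - s..e + s}"

lemma near_sets[simp, measurable]: "near e s \<in> sets lebesgue"
  by (simp add: near_def)

lemma inverse_weight_near:
  assumes e: "e \<in> {0, pi}" and s: "0 \<le> s" "s \<le> pi / 2"
  shows "integrable (lebesgue_on (near e s)) (\<lambda>x. 1 / weight x)"
    and "(LINT x|lebesgue_on (near e s). 1 / weight x) \<le> 8 * sqrt s"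
proof -
  let ?N = "lebesgue_on (near e s)"
  have sub: "near e s \<subseteq> {e - s..e + s}" "near e s \<subseteq> {0<..<pi}" by (auto simp: near_def)
  have i: "integrable ?N (\<lambda>x. 2 * (1 / sqrt \<bar>x - e\<bar>))"
    by (intro integrable_mult_right integrable_lebesgue_on_subset[OF inverse_sqrt_dist_lebesgue(1)[OF s(1)] sub(1)])
      auto
  have le: "1 / weight x \<le> 2 * (1 / sqrt \<bar>x - e\<bar>)" if "x \<in> near e s" for x
  proof -
    have x: "x \<in> {0<..<pi}" "\<bar>x - e\<bar> \<le> pi / 2" "x \<noteq> e" using that s e by (auto simp: near_def)
    then show ?thesis
      using weight_ge_sqrt_dist[OF e x(1,2)] weight_pos[OF x(1)] by (simp add: field_simps)
  qed
  have [measurable]: "weight \<in> borel_measurable ?N"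
    using measurable_restrict_mono[OF weight_measurable sub(2)] .
  show iw: "integrable ?N (\<lambda>x. 1 / weight x)"
  proof (rule Bochner_Integration.integrable_bound[OF i])
    show "AE x in ?N. norm (1 / weight x) \<le> norm (2 * (1 / sqrt \<bar>x - e\<bar>))"
    proof (rule AE_I2)
      fix x assume "x \<in> space ?N"
      then have x: "x \<in> near e s" by simp
      then have "0 < weight x" using sub(2) weight_pos by blast
      with le[OF x] show "norm (1 / weight x) \<le> norm (2 * (1 / sqrt \<bar>x - e\<bar>))" by simp
    qed
  qed simp
  have "(LINT x|?N. 1 / weight x) \<le> (LINT x|?N. 2 * (1 / sqrt \<bar>x - e\<bar>))"
    by (rule integral_mono[OF iw i]) (use le in auto)
  also have "\<dots> = 2 * (LINT x|?N. 1 / sqrt \<bar>x - e\<bar>)"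
    by (rule integral_mult_right_zero)
  also have "(LINT x|?N. 1 / sqrt \<bar>x - e\<bar>) \<le> (LINT x|lebesgue_on {e - s..e + s}. 1 / sqrt \<bar>x - e\<bar>)"
    by (rule integral_lebesgue_on_subset_mono[OF inverse_sqrt_dist_lebesgue(1)[OF s(1)]])
      (use sub in auto)
  also have "\<dots> = 4 * sqrt s" by (rule inverse_sqrt_dist_lebesgue(2)[OF s(1)])
  finally show "(LINT x|?N. 1 / weight x) \<le> 8 * sqrt s" by simp
qed

lemma integrable_inverse_weight: "integrable leb (\<lambda>x. 1 / weight x)"
proof -
  have "set_integrable lebesgue (near 0 (pi / 2) \<union> near pi (pi / 2)) (\<lambda>x. 1 / weight x)"
    using inverse_weight_near(1)[of 0 "pi / 2"] inverse_weight_near(1)[of pi "pi / 2"]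
    by (intro set_integrable_Un) (auto simp: integrable_restrict_space set_integrable_def)
  moreover have "near 0 (pi / 2) \<union> near pi (pi / 2) = {0<..<pi}"
    by (auto simp: near_def)
  ultimately show ?thesis by (simp add: integrable_restrict_space set_integrable_def)
qed

lemma integrable_if_weighted_square_integrable:
  assumes [measurable]: "g \<in> borel_measurable leb" and "integrable leb (\<lambda>x. weight x * (cmod (g x))\<^sup>2)"
  shows "integrable leb g"
proof -
  have "integrable leb (\<lambda>x. cmod (g x))"
    by (rule weighted_Cauchy_Schwarz(1)[OF _ _ _ assms(2) integrable_inverse_weight])
      (auto simp: space_restrict_space weight_pos)
  then show ?thesis by (simp add: integrable_norm_iff)
qed

text \<open>
  This is where the exponent in the trace inequality comes from: the integral of \<open>1/\<omega>\<close> over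
  points within distance \<open>s\<close> of an endpoint is of order \<open>s\<^bsup>1/2\<^esup>\<close>.
\<close>

lemma integral_near_bound:
  assumes [measurable]: "g \<in> borel_measurable leb" and A: "integrable leb (\<lambda>x. weight x * (cmod (g x))\<^sup>2)"
    and e: "e \<in> {0, pi}" and s: "0 \<le> s" "s \<le> pi / 2"
  shows "(LINT x|lebesgue_on (near e s). cmod (g x))\<^sup>2 \<le> 8 * sqrt s * (LINT x|leb. weight x * (cmod (g x))\<^sup>2)"
proof -
  let ?N = "lebesgue_on (near e s)"
  have sub: "near e s \<subseteq> {0<..<pi}" by (auto simp: near_def)
  have [measurable]: "g \<in> borel_measurable ?N"
    using measurable_restrict_mono[OF assms(1) sub] .
  have pos: "0 < weight x" if "x \<in> {0<..<pi}" for x using that by (rule weight_pos)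
  have A': "integrable ?N (\<lambda>x. weight x * (cmod (g x))\<^sup>2)"
    by (rule integrable_lebesgue_on_subset[OF A sub]) auto
  have "(LINT x|?N. cmod (g x))\<^sup>2 \<le> (LINT x|?N. weight x * (cmod (g x))\<^sup>2) * (LINT x|?N. 1 / weight x)"
    by (rule weighted_Cauchy_Schwarz(2)[OF _ _ _ A' inverse_weight_near(1)[OF e s]])
      (use sub pos in auto)
  also have "\<dots> \<le> (LINT x|leb. weight x * (cmod (g x))\<^sup>2) * (8 * sqrt s)"
  proof (rule mult_mono)
    show "(LINT x|?N. weight x * (cmod (g x))\<^sup>2) \<le> (LINT x|leb. weight x * (cmod (g x))\<^sup>2)"
      by (rule integral_lebesgue_on_subset_mono[OF A]) (use sub pos in \<open>auto simp: less_imp_le\<close>)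
    show "(LINT x|?N. 1 / weight x) \<le> 8 * sqrt s" by (rule inverse_weight_near(2)[OF e s])
    show "0 \<le> (LINT x|leb. weight x * (cmod (g x))\<^sup>2)"
      by (intro integral_nonneg_AE AE_I2) (auto simp: pos less_imp_le)
    show "0 \<le> (LINT x|?N. 1 / weight x)"
      by (intro integral_nonneg_AE AE_I2) (use sub pos in \<open>auto simp: less_imp_le\<close>)
  qed
  finally show ?thesis by (simp add: mult.commute)
qed

lemma cmod_primitive_diff_le:
  assumes g: "integrable leb g" and e: "e \<in> {0, pi}" and x: "x \<in> {0<..<pi}"
  shows "cmod (primitive g x - primitive g e) \<le> (LINT t|lebesgue_on (near e \<bar>x - e\<bar>). cmod (g t))"
proof -
  have int: "integrable leb (\<lambda>t. indicator {..<y} t *\<^sub>R g t)" for y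
  proof (rule Bochner_Integration.integrable_bound[OF g])
    have [measurable]: "g \<in> borel_measurable leb" using g by (rule borel_measurable_integrable)
    show "(\<lambda>t. indicator {..<y} t *\<^sub>R g t) \<in> borel_measurable leb" by measurable
  qed (auto simp: indicator_def)
  have "primitive g x - primitive g e
      = (LINT t|leb. indicator {..<x} t *\<^sub>R g t - indicator {..<e} t *\<^sub>R g t)"
    unfolding primitive_def by (rule Bochner_Integration.integral_diff[OF int int, symmetric])
  also have "cmod \<dots> \<le> (LINT t|leb. cmod (indicator {..<x} t *\<^sub>R g t - indicator {..<e} t *\<^sub>R g t))"
    by (rule integral_norm_bound)
  also have "\<dots> \<le> (LINT t|leb. indicator (near e \<bar>x - e\<bar>) t * cmod (g t))"
  proof (rule integral_mono)
    show "integrable leb (\<lambda>t. cmod (indicator {..<x} t *\<^sub>R g t - indicator {..<e} t *\<^sub>R g t))"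
      by (intro integrable_norm Bochner_Integration.integrable_diff int)
    have "near e \<bar>x - e\<bar> \<in> sets leb"
      by (simp add: sets_restrict_space_iff near_def)
    from integrable_mult_indicator[OF this integrable_norm[OF g]]
    show "integrable leb (\<lambda>t. indicator (near e \<bar>x - e\<bar>) t * cmod (g t))" by simp
    fix t assume "t \<in> space leb"
    then have "t \<in> {0<..<pi}" by simp
    then show "cmod (indicator {..<x} t *\<^sub>R g t - indicator {..<e} t *\<^sub>R g t)
        \<le> indicator (near e \<bar>x - e\<bar>) t * cmod (g t)"
      using e x by (auto simp: indicator_def near_def)
  qed
  also have "\<dots> = (LINT t|lebesgue. indicator (near e \<bar>x - e\<bar>) t *\<^sub>R cmod (g t))"
    unfolding integral_leb
    by (intro Bochner_Integration.integral_cong) (auto simp: indicator_def near_def)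
  also have "\<dots> = (LINT t|lebesgue_on (near e \<bar>x - e\<bar>). cmod (g t))"
    by (simp add: integral_restrict_space)
  finally show ?thesis .
qed

section \<open>The quantitative bound at an endpoint\<close>

lemma cmod_squared_le_twice: "(cmod a)\<^sup>2 \<le> 2 * (cmod b)\<^sup>2 + 2 * (cmod (b - a))\<^sup>2"
  using cmod_add_squared_le[of b "a - b"] by (simp add: norm_minus_commute)

text \<open>
  Let \<open>J\<close> be the set of points whose distance to \<open>e\<close> lies between \<open>\<epsilon>\<^sup>2/2\<close> and \<open>\<epsilon>\<^sup>2\<close>. Its length is
  \<open>\<epsilon>\<^sup>2/2\<close>, the weight on it is at least \<open>\<epsilon>/4\<close>, and the continuous representative moves by at most
  \<open>(8\<epsilon> \<integral>\<omega>|g|\<^sup>2)\<^bsup>1/2\<^esup>\<close> between \<open>e\<close> and a point of \<open>J\<close>. Integrating the resulting pointwise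
  bound over \<open>J\<close> and dividing by the length gives the claim.
\<close>

lemma endpoint_bound:
  assumes e: "e \<in> {0, pi}" and \<epsilon>: "0 < \<epsilon>" "\<epsilon> \<le> 1"
    and [measurable]: "f \<in> borel_measurable leb"
    and N: "integrable leb (\<lambda>x. weight x * (cmod (f x))\<^sup>2)"
    and [measurable]: "g \<in> borel_measurable leb"
    and A: "integrable leb (\<lambda>x. weight x * (cmod (g x))\<^sup>2)"
    and f: "AE x in leb. f x = c + primitive g x"
  shows "(cmod (c + primitive g e))\<^sup>2 \<le> 16 * (\<epsilon> * (LINT x|leb. weight x * (cmod (g x))\<^sup>2)
    + (LINT x|leb. weight x * (cmod (f x))\<^sup>2) / \<epsilon> ^ 3)"
proof -
  define a where "a = (LINT x|leb. weight x * (cmod (g x))\<^sup>2)"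
  define n where "n = (LINT x|leb. weight x * (cmod (f x))\<^sup>2)"
  define t where "t = (cmod (c + primitive g e))\<^sup>2"
  \<comment> \<open>The left end of \<open>J\<close>: the set lies to the right of 0 but to the left of \<open>\<pi>\<close>.\<close>
  define p where "p = (if e = 0 then \<epsilon>\<^sup>2 / 2 else pi - \<epsilon>\<^sup>2)"
  define J where "J = {p..p + \<epsilon>\<^sup>2 / 2}"
  have \<epsilon>2: "0 < \<epsilon>\<^sup>2" "\<epsilon>\<^sup>2 \<le> 1" using \<epsilon> by (auto simp: power_le_one)
  have J: "x \<in> {0<..<pi}" "\<epsilon>\<^sup>2 / 2 \<le> \<bar>x - e\<bar>" "\<bar>x - e\<bar> \<le> \<epsilon>\<^sup>2" if "x \<in> J" for x
  proof -
    \<comment> \<open>With \<open>\<epsilon>\<^sup>2\<close> as an atom the claims are linear.\<close>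
    obtain r where r: "r = \<epsilon>\<^sup>2" by simp
    show "x \<in> {0<..<pi}" "\<epsilon>\<^sup>2 / 2 \<le> \<bar>x - e\<bar>" "\<bar>x - e\<bar> \<le> \<epsilon>\<^sup>2"
      using that e \<epsilon>2 pi_gt3 unfolding J_def p_def r[symmetric] by (auto split: if_splits)
  qed
  have Js: "J \<in> sets leb"
    using J(1) by (auto simp: sets_restrict_space_iff J_def)
  have JI: "J \<inter> {0<..<pi} = J" using J(1) by blast
  have mJ: "measure leb J = \<epsilon>\<^sup>2 / 2"
    using J(1) \<epsilon>2 by (subst measure_restrict_space) (auto simp: J_def)
  have g: "integrable leb g"
    by (rule integrable_if_weighted_square_integrable[OF _ A]) simp
  have a0: "0 \<le> a"
    unfolding a_def by (intro integral_nonneg_AE AE_I2) (auto simp: weight_pos less_imp_le)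
  have pointwise: "t \<le> 8 / \<epsilon> * (weight x * (cmod (f x))\<^sup>2) + 16 * \<epsilon> * a"
    if "x \<in> J" and fx: "f x = c + primitive g x" for x
  proof -
    note x = J[OF that(1)]
    have half: "\<bar>x - e\<bar> \<le> pi / 2" using x(3) \<epsilon>2 pi_gt3 by simp
    have "cmod (f x - (c + primitive g e)) \<le> (LINT t|lebesgue_on (near e \<bar>x - e\<bar>). cmod (g t))"
      using cmod_primitive_diff_le[OF g e x(1)] by (simp add: fx)
    then have "(cmod (f x - (c + primitive g e)))\<^sup>2 \<le> (LINT t|lebesgue_on (near e \<bar>x - e\<bar>). cmod (g t))\<^sup>2"
      by (rule power_mono) simp
    also have "\<dots> \<le> 8 * sqrt \<bar>x - e\<bar> * a"
      unfolding a_def by (rule integral_near_bound[OF _ A e _ half]) auto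
    also have "\<dots> \<le> 8 * \<epsilon> * a"
    proof -
      have "sqrt \<bar>x - e\<bar> \<le> sqrt (\<epsilon>\<^sup>2)" using x(3) by (rule real_sqrt_le_mono)
      then show ?thesis using a0 \<epsilon> by (intro mult_right_mono) auto
    qed
    finally have 1: "(cmod (f x - (c + primitive g e)))\<^sup>2 \<le> 8 * \<epsilon> * a" .
    have "\<epsilon> / 4 \<le> weight x"
    proof -
      have "(\<epsilon> / 2)\<^sup>2 = \<epsilon>\<^sup>2 / 4" by (simp add: power_divide)
      then have "(\<epsilon> / 2)\<^sup>2 \<le> \<bar>x - e\<bar>" using x(2) \<epsilon>2(1) by linarith
      then have "\<epsilon> / 2 \<le> sqrt \<bar>x - e\<bar>" by (rule real_le_rsqrt)
      then show ?thesis using weight_ge_sqrt_dist[OF e x(1) half] by simp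
    qed
    then have "\<epsilon> / 4 * (cmod (f x))\<^sup>2 \<le> weight x * (cmod (f x))\<^sup>2"
      by (rule mult_right_mono) simp
    then have 2: "2 * (cmod (f x))\<^sup>2 \<le> 8 / \<epsilon> * (weight x * (cmod (f x))\<^sup>2)"
      using \<epsilon> by (simp add: field_simps)
    show ?thesis
      using cmod_squared_le_twice[of "c + primitive g e" "f x"] 1 2 by (simp add: t_def)
  qed
  interpret finite_measure leb by (rule finite_measure_leb)
  have iJ: "integrable leb (\<lambda>x. indicator J x * d)" for d :: real
    using Js by (intro integrable_mult_left integrable_real_indicator) (auto simp: less_top[symmetric])
  have "(LINT x|leb. indicator J x * t)
      \<le> (LINT x|leb. 8 / \<epsilon> * (weight x * (cmod (f x))\<^sup>2) + indicator J x * (16 * \<epsilon> * a))"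
  proof (rule integral_mono_AE)
    show "integrable leb (\<lambda>x. indicator J x * t)" by (rule iJ)
    show "integrable leb (\<lambda>x. 8 / \<epsilon> * (weight x * (cmod (f x))\<^sup>2) + indicator J x * (16 * \<epsilon> * a))"
      by (intro Bochner_Integration.integrable_add integrable_mult_right N iJ)
    have "AE x in leb. x \<in> {0<..<pi}" by (intro AE_I2) simp
    with f show "AE x in leb. indicator J x * t
        \<le> 8 / \<epsilon> * (weight x * (cmod (f x))\<^sup>2) + indicator J x * (16 * \<epsilon> * a)"
    proof eventually_elim
      case (elim x)
      show ?case
      proof (cases "x \<in> J")
        case True
        with pointwise[OF True elim(1)] show ?thesis by simp
      next
        case False
        then show ?thesis using weight_pos[OF elim(2)] \<epsilon> by (simp add: less_imp_le)
      qed
    qed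
  qed
  also have "\<dots> = 8 / \<epsilon> * n + \<epsilon>\<^sup>2 / 2 * (16 * \<epsilon> * a)"
    unfolding Bochner_Integration.integral_add[OF integrable_mult_right[OF N] iJ]
      integral_mult_right_zero integral_mult_left_zero n_def
    by (simp add: mJ JI)
  finally have "\<epsilon>\<^sup>2 / 2 * t \<le> 8 / \<epsilon> * n + \<epsilon>\<^sup>2 / 2 * (16 * \<epsilon> * a)"
    by (simp add: mJ JI)
  then have "t \<le> 16 * (\<epsilon> * a + n / \<epsilon> ^ 3)"
    using \<epsilon> by (simp add: field_simps power2_eq_square power3_eq_cube)
  then show ?thesis by (simp add: t_def a_def n_def)
qed

text \<open>
  The two terms balance at \<open>\<epsilon>\<^sup>4 = N\<^sup>2/a\<close>, which is admissible when \<open>N\<^sup>2 < a\<close>. Otherwise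
  \<open>\<epsilon> = 1\<close> already gives a multiple of \<open>N\<^sup>2\<close>. If \<open>N = 0\<close>, letting \<open>\<epsilon>\<close> tend to zero forces \<open>t = 0\<close>.
\<close>

lemma optimize_epsilon:
  fixes a N t K :: real
  assumes nonneg: "0 \<le> a" "0 \<le> N" "0 \<le> t" "0 \<le> K"
    and bound: "\<And>\<epsilon>. 0 < \<epsilon> \<Longrightarrow> \<epsilon> \<le> 1 \<Longrightarrow> t \<le> K * (\<epsilon> * a + N\<^sup>2 / \<epsilon> ^ 3)"
  shows "t \<le> 2 * K * (a powr (3/4) * N powr (1/2) + N\<^sup>2)"
proof -
  consider "N = 0" | "a \<le> N\<^sup>2" | "0 < N" "N\<^sup>2 < a" using nonneg by linarith
  then show ?thesis
  proof cases
    case 1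
    have "t \<le> 0 + d" if "0 < d" for d
    proof -
      \<comment> \<open>The summand 1 keeps the denominator positive when \<open>K * a = 0\<close>.\<close>
      define \<epsilon> where "\<epsilon> = min 1 (d / (K * a + 1))"
      have Ka: "0 \<le> K * a" using nonneg by simp
      then have \<epsilon>: "0 < \<epsilon>" "\<epsilon> \<le> 1" "\<epsilon> \<le> d / (K * a + 1)" using that by (auto simp: \<epsilon>_def)
      have "t \<le> \<epsilon> * (K * a)" using bound[OF \<epsilon>(1,2)] 1 by (simp add: mult_ac)
      also have "\<dots> \<le> d / (K * a + 1) * (K * a)" using \<epsilon>(3) Ka by (rule mult_right_mono)
      also have "\<dots> \<le> d" using Ka that by (simp add: field_simps)
      finally show ?thesis by simp
    qed
    then have "t \<le> 0" by (rule field_le_epsilon)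
    then show ?thesis using 1 by simp
  next
    case 2
    have "t \<le> K * (a + N\<^sup>2)" using bound[of 1] by simp
    also have "\<dots> \<le> K * (2 * N\<^sup>2)" using 2 nonneg by (intro mult_left_mono) auto
    also have "\<dots> \<le> 2 * K * (a powr (3/4) * N powr (1/2) + N\<^sup>2)"
      using nonneg by (simp add: algebra_simps)
    finally show ?thesis .
  next
    case 3
    then have a: "0 < a" by (smt (verit) zero_le_power2)
    define \<epsilon> where "\<epsilon> = N powr (1/2) / a powr (1/4)"
    have N2: "N\<^sup>2 = N powr 2" using 3 by (simp add: powr_numeral)
    have "N powr (1/2) = (N powr 2) powr (1/4)" by (simp add: powr_powr)
    also have "\<dots> \<le> a powr (1/4)"
      using 3 unfolding N2[symmetric] by (intro powr_mono2) auto
    finally have \<epsilon>: "0 < \<epsilon>" "\<epsilon> \<le> 1" using 3 a by (auto simp: \<epsilon>_def)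
    have "\<epsilon> * a = N powr (1/2) * (a powr 1 / a powr (1/4))" using a by (simp add: \<epsilon>_def)
    also have "a powr 1 / a powr (1/4) = a powr (3/4)" by (simp only: powr_diff[symmetric]) simp
    finally have e1: "\<epsilon> * a = a powr (3/4) * N powr (1/2)" by simp
    have "\<epsilon> ^ 3 = N powr (3/2) / a powr (3/4)"
      using 3 a by (simp add: \<epsilon>_def power_divide powr_power)
    then have "N\<^sup>2 / \<epsilon> ^ 3 = N powr 2 / N powr (3/2) * a powr (3/4)" unfolding N2 by simp
    also have "N powr 2 / N powr (3/2) = N powr (1/2)" by (simp only: powr_diff[symmetric]) simp
    finally have e2: "N\<^sup>2 / \<epsilon> ^ 3 = a powr (3/4) * N powr (1/2)" by simp
    have "t \<le> 2 * K * (a powr (3/4) * N powr (1/2))"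
      using bound[OF \<epsilon>] unfolding e1 e2 by (simp add: mult_ac)
    also have "\<dots> \<le> 2 * K * (a powr (3/4) * N powr (1/2) + N\<^sup>2)"
      using nonneg by (intro mult_left_mono) auto
    finally show ?thesis .
  qed
qed

section \<open>Endpoint traces on the form domain\<close>

lemma measurable_weighted_measure:
  "f \<in> borel_measurable weighted_measure \<longleftrightarrow> f \<in> borel_measurable leb"
  by (simp add: weighted_measure_def)

lemma AE_weight_nonneg: "AE x in leb. 0 \<le> weight x"
  by (intro AE_I2) (auto simp: weight_pos less_imp_le)

lemma weighted_measure_square:
  assumes [measurable]: "(f :: real \<Rightarrow> complex) \<in> borel_measurable leb"
  shows "integrable weighted_measure (\<lambda>x. (cmod (f x))\<^sup>2) \<longleftrightarrow> integrable leb (\<lambda>x. weight x * (cmod (f x))\<^sup>2)"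
    and "(LINT x|weighted_measure. (cmod (f x))\<^sup>2) = (LINT x|leb. weight x * (cmod (f x))\<^sup>2)"
  unfolding weighted_measure_def using AE_weight_nonneg
  by (simp_all add: integrable_density integral_density)

lemma weighted_square_nonneg: "0 \<le> (LINT x|leb. weight x * (cmod (f x))\<^sup>2)"
  by (intro integral_nonneg_AE AE_I2) (auto simp: weight_pos less_imp_le)

lemma norm_H_squared:
  assumes "f \<in> borel_measurable leb"
  shows "(norm_H f)\<^sup>2 = (LINT x|leb. weight x * (cmod (f x))\<^sup>2)"
  unfolding norm_H_def weighted_measure_square(2)[OF assms]
  by (simp add: weighted_square_nonneg)

lemma weighted_square_cong_AE:
  assumes [measurable]: "f \<in> borel_measurable leb" "g \<in> borel_measurable leb"
    and ae: "AE x in leb. f x = (g x :: complex)"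
  shows "integrable leb (\<lambda>x. weight x * (cmod (f x))\<^sup>2) \<longleftrightarrow> integrable leb (\<lambda>x. weight x * (cmod (g x))\<^sup>2)"
    and "(LINT x|leb. weight x * (cmod (f x))\<^sup>2) = (LINT x|leb. weight x * (cmod (g x))\<^sup>2)"
proof -
  have *: "AE x in leb. weight x * (cmod (f x))\<^sup>2 = weight x * (cmod (g x))\<^sup>2"
    using ae by eventually_elim simp
  show "integrable leb (\<lambda>x. weight x * (cmod (f x))\<^sup>2) \<longleftrightarrow> integrable leb (\<lambda>x. weight x * (cmod (g x))\<^sup>2)"
    using * by (intro integrable_cong_AE) simp_all
  show "(LINT x|leb. weight x * (cmod (f x))\<^sup>2) = (LINT x|leb. weight x * (cmod (g x))\<^sup>2)"
    using * by (intro integral_cong_AE) simp_all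
qed

lemma weighted_square_diff:
  assumes [measurable]: "f \<in> borel_measurable leb" "g \<in> borel_measurable leb"
    and "integrable leb (\<lambda>x. weight x * (cmod (f x))\<^sup>2)" "integrable leb (\<lambda>x. weight x * (cmod (g x))\<^sup>2)"
  shows "integrable leb (\<lambda>x. weight x * (cmod (f x - g x))\<^sup>2)"
proof (rule Bochner_Integration.integrable_bound)
  show "integrable leb (\<lambda>x. 2 * (weight x * (cmod (f x))\<^sup>2) + 2 * (weight x * (cmod (g x))\<^sup>2))"
    using assms by (intro Bochner_Integration.integrable_add integrable_mult_right)
  show "AE x in leb. norm (weight x * (cmod (f x - g x))\<^sup>2)
      \<le> norm (2 * (weight x * (cmod (f x))\<^sup>2) + 2 * (weight x * (cmod (g x))\<^sup>2))"
  proof (rule AE_I2)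
    fix x assume "x \<in> space leb"
    then have w: "0 \<le> weight x" using weight_pos[of x] by simp
    have "weight x * (cmod (f x - g x))\<^sup>2 \<le> weight x * (2 * (cmod (f x))\<^sup>2 + 2 * (cmod (g x))\<^sup>2)"
      using cmod_add_squared_le[of "f x" "- g x"] w by (intro mult_left_mono) auto
    then show "norm (weight x * (cmod (f x - g x))\<^sup>2)
      \<le> norm (2 * (weight x * (cmod (f x))\<^sup>2) + 2 * (weight x * (cmod (g x))\<^sup>2))"
      using w by (simp add: algebra_simps)
  qed
qed measurable

lemma has_weak_deriv_measurable:
  assumes "has_weak_deriv f g"
  shows "f \<in> borel_measurable leb" "g \<in> borel_measurable leb"
  using assms by (auto simp: has_weak_deriv_def L2_loc_def)

lemma AE_weak_deriv:
  assumes "has_weak_deriv f g"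
  shows "AE x in leb. weak_deriv f x = g x"
proof -
  have "f \<in> H1_loc" unfolding H1_loc_def using assms by blast
  then show ?thesis
    using has_weak_deriv_unique[OF has_weak_deriv_weak_deriv assms] by blast
qed

text \<open>
  Membership, and likewise the form below, can be tested with any weak derivative, because weak
  derivatives agree almost everywhere. This is what makes the choice made by \<open>weak_deriv\<close> harmless.
\<close>

lemma space_V_iff:
  assumes fg: "has_weak_deriv f g"
  shows "f \<in> space_V \<longleftrightarrow> integrable leb (\<lambda>x. weight x * (cmod (f x))\<^sup>2) \<and>
    integrable leb (\<lambda>x. weight x * (cmod (g x))\<^sup>2)"
proof -
  have H1: "f \<in> H1_loc" unfolding H1_loc_def using fg by blast
  note m = has_weak_deriv_measurable[OF fg]
  note w = has_weak_deriv_measurable(2)[OF has_weak_deriv_weak_deriv[OF H1]]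
  show ?thesis
    using H1 weighted_square_cong_AE(1)[OF w m(2) AE_weak_deriv[OF fg]]
    by (simp add: space_V_def space_H_def measurable_weighted_measure m weighted_measure_square(1) w)
qed

lemma form_a0_eq:
  assumes fg: "has_weak_deriv f g"
  shows "Re (form_a0 f f) = 4 * (LINT x|leb. weight x * (cmod (g x))\<^sup>2)"
proof -
  have H1: "f \<in> H1_loc" unfolding H1_loc_def using fg by blast
  note m = has_weak_deriv_measurable[OF fg]
  note w = has_weak_deriv_measurable(2)[OF has_weak_deriv_weak_deriv[OF H1]]
  have "form_a0 f f = 4 * (LINT x|weighted_measure. complex_of_real ((cmod (weak_deriv f x))\<^sup>2))"
    by (simp only: form_a0_def complex_norm_square)
  also have "\<dots> = complex_of_real (4 * (LINT x|weighted_measure. (cmod (weak_deriv f x))\<^sup>2))"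
    by (simp only: integral_complex_of_real) simp
  finally have "Re (form_a0 f f) = 4 * (LINT x|weighted_measure. (cmod (weak_deriv f x))\<^sup>2)"
    by (simp only: Re_complex_of_real)
  then show ?thesis
    unfolding weighted_measure_square(2)[OF w] weighted_square_cong_AE(2)[OF w m(2) AE_weak_deriv[OF fg]] .
qed

lemma space_V_weak_deriv: "f \<in> space_V \<Longrightarrow> has_weak_deriv f (weak_deriv f)"
  by (simp add: space_V_def has_weak_deriv_weak_deriv)

lemma space_V_diff:
  assumes f: "f \<in> space_V" and g: "g \<in> space_V"
  shows "(\<lambda>x. f x - g x) \<in> space_V"
proof -
  note wf = space_V_weak_deriv[OF f] and wg = space_V_weak_deriv[OF g]
  note mf = has_weak_deriv_measurable[OF wf] and mg = has_weak_deriv_measurable[OF wg]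
  show ?thesis
    unfolding space_V_iff[OF has_weak_deriv_diff[OF wf wg]]
    using f g weighted_square_diff mf mg by (simp add: space_V_iff[OF wf] space_V_iff[OF wg])
qed

definition continuous_rep :: "(real \<Rightarrow> complex) \<Rightarrow> (real \<Rightarrow> complex) \<Rightarrow> bool" where
  "continuous_rep f F \<longleftrightarrow> continuous_on {0..pi} F \<and> (AE x in leb. f x = F x)"

lemma continuous_rep_primitive:
  assumes "f \<in> space_V"
  shows "\<exists>c. continuous_rep f (\<lambda>x. c + primitive (weak_deriv f) x) \<and> (AE x in leb. f x = c + primitive (weak_deriv f) x)"
proof -
  note w = space_V_weak_deriv[OF assms]
  have i: "integrable leb (weak_deriv f)"
    using assms has_weak_deriv_measurable[OF w] space_V_iff[OF w]
    by (intro integrable_if_weighted_square_integrable) auto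
  from AE_eq_constant_plus_primitive[OF w i] obtain c where
    "AE x in leb. f x = c + primitive (weak_deriv f) x" ..
  moreover have "continuous_on {0..pi} (\<lambda>x. c + primitive (weak_deriv f) x)"
    by (intro continuous_intros continuous_on_primitive i)
  ultimately show ?thesis unfolding continuous_rep_def by (intro exI[of _ c]) simp
qed

text \<open>
  Two continuous functions that agree almost everywhere on \<open>(0,\<pi>)\<close> agree on a closed set that
  contains \<open>(0,\<pi>)\<close>, hence also at the endpoints.
\<close>

lemma continuous_rep_unique:
  assumes "continuous_rep f F" "continuous_rep f G" and x: "x \<in> {0..pi}"
  shows "F x = G x"
proof -
  have "continuous_on {0..pi} (\<lambda>x. F x - G x)"
    using assms by (intro continuous_intros) (auto simp: continuous_rep_def)
  then have closed: "closed {x \<in> {0..pi}. F x - G x = 0}"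
    by (intro continuous_closed_preimage_constant) auto
  have "AE x in leb. f x = F x" "AE x in leb. f x = G x"
    using assms by (auto simp: continuous_rep_def)
  then have "AE x in leb. F x - G x = 0"
    by eventually_elim simp
  then have ae: "AE x \<in> {0<..<pi} in lebesgue. x \<in> {x \<in> {0..pi}. F x - G x = 0}"
    unfolding AE_leb by eventually_elim auto
  have "{0<..<pi} \<subseteq> {x \<in> {0..pi}. F x - G x = 0}"
    using mem_closed_if_AE_lebesgue_open[OF _ closed ae] by auto
  then have "closure {0<..<pi} \<subseteq> {x \<in> {0..pi}. F x - G x = 0}"
    using closed by (rule closure_minimal)
  then show ?thesis using x by (auto simp: closure_greaterThanLessThan)
qed

text \<open>
  The representative depends on \<open>f\<close> only through its class modulo null sets, and its uniqueness
  on \<open>[0,\<pi>]\<close> yields linearity of the trace without any reference to weak derivatives.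
\<close>

definition trace_at :: "real \<Rightarrow> (real \<Rightarrow> complex) \<Rightarrow> complex" where
  "trace_at e f = (SOME F. continuous_rep f F) e"

lemma trace_at_eq:
  assumes "continuous_rep f F" "e \<in> {0, pi}"
  shows "trace_at e f = F e"
  unfolding trace_at_def
  by (rule continuous_rep_unique[OF someI[of "continuous_rep f", OF assms(1)] assms(1)])
    (use assms(2) in auto)

lemma trace_at_bound:
  assumes f: "f \<in> space_V" and e: "e \<in> {0, pi}" and \<epsilon>: "0 < \<epsilon>" "\<epsilon> \<le> 1"
  shows "(cmod (trace_at e f))\<^sup>2 \<le> 16 * (\<epsilon> * Re (form_a0 f f) + (norm_H f)\<^sup>2 / \<epsilon> ^ 3)"
proof -
  note w = space_V_weak_deriv[OF f]
  note m = has_weak_deriv_measurable[OF w]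
  obtain c where c: "continuous_rep f (\<lambda>x. c + primitive (weak_deriv f) x)"
    "AE x in leb. f x = c + primitive (weak_deriv f) x"
    using continuous_rep_primitive[OF f] by (elim exE conjE)
  let ?A = "LINT x|leb. weight x * (cmod (weak_deriv f x))\<^sup>2"
  have "(cmod (trace_at e f))\<^sup>2 \<le> 16 * (\<epsilon> * ?A + (norm_H f)\<^sup>2 / \<epsilon> ^ 3)"
    unfolding trace_at_eq[OF c(1) e] norm_H_squared[OF m(1)]
    by (rule endpoint_bound[OF e \<epsilon> m(1) _ m(2) _ c(2)])
      (use f in \<open>simp_all add: space_V_iff[OF w]\<close>)
  also have "\<epsilon> * ?A \<le> \<epsilon> * Re (form_a0 f f)"
    unfolding form_a0_eq[OF w] using \<epsilon> weighted_square_nonneg[of "weak_deriv f"]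
    by (intro mult_left_mono) auto
  finally show ?thesis by simp
qed

lemma form_a0_nonneg: "f \<in> space_V \<Longrightarrow> 0 \<le> Re (form_a0 f f)"
  by (simp add: form_a0_eq[OF space_V_weak_deriv] weighted_square_nonneg)

lemma norm_H_nonneg: "0 \<le> norm_H f"
  by (simp add: norm_H_def)

lemma trace_at_le_norm_V:
  assumes f: "f \<in> space_V" and e: "e \<in> {0, pi}"
  shows "cmod (trace_at e f) \<le> 4 * norm_V f"
proof (rule power2_le_imp_le)
  have "(cmod (trace_at e f))\<^sup>2 \<le> 16 * (Re (form_a0 f f) + (norm_H f)\<^sup>2)"
    using trace_at_bound[OF f e zero_less_one] by simp
  also have "\<dots> = (4 * norm_V f)\<^sup>2"
    using form_a0_nonneg[OF f] by (simp add: norm_V_def power_mult_distrib)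
  finally show "(cmod (trace_at e f))\<^sup>2 \<le> (4 * norm_V f)\<^sup>2" .
  show "0 \<le> 4 * norm_V f"
    using form_a0_nonneg[OF f] by (simp add: norm_V_def)
qed

lemma space_V_continuous_rep:
  assumes "f \<in> space_V"
  shows "\<exists>F. continuous_rep f F"
  using continuous_rep_primitive[OF assms] by (elim exE conjE) (rule exI)

text \<open>
  The form norm does not distinguish \<open>f\<close> from its continuous representative. This is the density
  of continuous functions in the form domain, in the strongest possible form, and it is what
  forces uniqueness of the trace.
\<close>

lemma continuous_rep_in_space_V:
  assumes f: "f \<in> space_V" and F: "continuous_rep f F"
  shows "F \<in> space_V" "norm_V (\<lambda>x. F x - f x) = 0"
proof -
  note w = space_V_weak_deriv[OF f]
  have ae: "AE x in leb. f x = F x" and "F \<in> L2_loc"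
    using F by (auto simp: continuous_rep_def intro: continuous_on_L2_loc)
  then have wF: "has_weak_deriv F (weak_deriv f)"
    by (intro has_weak_deriv_cong_AE[OF w])
  note m = has_weak_deriv_measurable(1)[OF w] has_weak_deriv_measurable(1)[OF wF]
  show "F \<in> space_V"
    using f unfolding space_V_iff[OF w] space_V_iff[OF wF] weighted_square_cong_AE(1)[OF m ae] .
  have w0: "has_weak_deriv (\<lambda>x. F x - f x) (\<lambda>x. 0)"
    using has_weak_deriv_diff[OF wF w] by simp
  have ae0: "AE x in leb. F x - f x = 0"
    using ae by eventually_elim simp
  have "(norm_H (\<lambda>x. F x - f x))\<^sup>2 = (LINT x|leb. weight x * (cmod 0)\<^sup>2)"
    unfolding norm_H_squared[OF has_weak_deriv_measurable(1)[OF w0]]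
    by (rule weighted_square_cong_AE(2)[OF has_weak_deriv_measurable[OF w0] ae0])
  then show "norm_V (\<lambda>x. F x - f x) = 0"
    by (simp add: norm_V_def form_a0_eq[OF w0])
qed

lemma endpoint_trace_trace_at:
  assumes e: "e \<in> {0, pi}"
  shows "endpoint_trace e (trace_at e)"
  unfolding endpoint_trace_def
proof (intro conjI ballI allI impI)
  fix f assume f: "f \<in> space_V"
  obtain F where F: "continuous_rep f F" using space_V_continuous_rep[OF f] ..
  show "trace_at e (\<lambda>x. z * f x) = z * trace_at e f" for z
  proof -
    have "continuous_rep (\<lambda>x. z * f x) (\<lambda>x. z * F x)"
      using F by (auto simp: continuous_rep_def intro: continuous_intros elim!: eventually_mono)
    then show ?thesis using F by (simp add: trace_at_eq[OF _ e])
  qed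
  show "trace_at e f = f e" if "continuous_on {0..pi} f"
    by (rule trace_at_eq[OF _ e]) (simp add: continuous_rep_def that)
  {
    fix g assume g: "g \<in> space_V"
    obtain G where G: "continuous_rep g G" using space_V_continuous_rep[OF g] ..
    have ae: "AE x in leb. f x = F x" "AE x in leb. g x = G x"
      using F G by (auto simp: continuous_rep_def)
    have "AE x in leb. f x + g x = F x + G x" "AE x in leb. g x - f x = G x - F x"
      using ae by (eventually_elim, simp)+
    then have "continuous_rep (\<lambda>x. f x + g x) (\<lambda>x. F x + G x)"
      "continuous_rep (\<lambda>x. g x - f x) (\<lambda>x. G x - F x)"
      using F G by (auto simp: continuous_rep_def intro: continuous_intros)
    then have "trace_at e (\<lambda>x. f x + g x) = trace_at e f + trace_at e g"
      "trace_at e (\<lambda>x. g x - f x) = trace_at e g - trace_at e f"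
      using F G by (simp_all add: trace_at_eq[OF _ e])
  }
  note lin = this
  show "trace_at e (\<lambda>x. f x + g x) = trace_at e f + trace_at e g" if "g \<in> space_V" for g
    using lin(1)[OF that] .
  fix d :: real assume d: "0 < d"
  show "\<exists>\<delta>>0. \<forall>g\<in>space_V. norm_V (\<lambda>x. g x - f x) < \<delta> \<longrightarrow> cmod (trace_at e g - trace_at e f) < d"
  proof (intro exI[of _ "d / 4"] conjI ballI impI)
    fix g assume g: "g \<in> space_V" and small: "norm_V (\<lambda>x. g x - f x) < d / 4"
    have "cmod (trace_at e g - trace_at e f) \<le> 4 * norm_V (\<lambda>x. g x - f x)"
      using trace_at_le_norm_V[OF space_V_diff[OF g f] e] by (simp add: lin(2)[OF g])
    with small show "cmod (trace_at e g - trace_at e f) < d" by simp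
  qed (use d in simp)
qed

lemma endpoint_trace_unique:
  assumes e: "e \<in> {0, pi}" and T: "endpoint_trace e T" and f: "f \<in> space_V"
  shows "T f = trace_at e f"
proof -
  obtain F where F: "continuous_rep f F" using space_V_continuous_rep[OF f] ..
  note V = continuous_rep_in_space_V[OF f F]
  have "cmod (T F - T f) < d" if "0 < d" for d
  proof -
    obtain \<delta> where "0 < \<delta>" "\<forall>g\<in>space_V. norm_V (\<lambda>x. g x - f x) < \<delta> \<longrightarrow> cmod (T g - T f) < d"
      using T f \<open>0 < d\<close> unfolding endpoint_trace_def by blast
    then show ?thesis using V by simp
  qed
  then have "cmod (T F - T f) \<le> 0" by (meson less_irrefl not_le)
  then have "T f = T F" by simp
  also have "\<dots> = F e"
    using T V(1) F unfolding endpoint_trace_def continuous_rep_def by blast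
  also have "\<dots> = trace_at e f" using trace_at_eq[OF F e] by simp
  finally show ?thesis .
qed

theorem theorem5p2:
  "\<exists>T0 Tpi :: (real \<Rightarrow> complex) \<Rightarrow> complex.
     endpoint_trace 0 T0 \<and> (\<forall>T. endpoint_trace 0 T \<longrightarrow> (\<forall>f\<in>space_V. T f = T0 f)) \<and>
     endpoint_trace pi Tpi \<and> (\<forall>T. endpoint_trace pi T \<longrightarrow> (\<forall>f\<in>space_V. T f = Tpi f)) \<and>
     (\<exists>C>0. \<forall>f\<in>space_V.
        (cmod (T0 f))\<^sup>2 + (cmod (Tpi f))\<^sup>2
          \<le> C * (Re (form_a0 f f) powr (3/4) * norm_H f powr (1/2) + (norm_H f)\<^sup>2)) \<and>
     (\<exists>C>0. \<forall>\<epsilon>\<in>{0<..1}. \<forall>f\<in>space_V.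
        (cmod (T0 f))\<^sup>2 + (cmod (Tpi f))\<^sup>2
          \<le> C * (\<epsilon> * Re (form_a0 f f) + \<epsilon> powi (-3) * (norm_H f)\<^sup>2))"
proof (rule exI[of _ "trace_at 0"], rule exI[of _ "trace_at pi"], intro conjI)
  have bound: "(cmod (trace_at 0 f))\<^sup>2 + (cmod (trace_at pi f))\<^sup>2
      \<le> 32 * (\<epsilon> * Re (form_a0 f f) + (norm_H f)\<^sup>2 / \<epsilon> ^ 3)"
    if "f \<in> space_V" "0 < \<epsilon>" "\<epsilon> \<le> 1" for f \<epsilon>
    using trace_at_bound[OF that(1) _ that(2,3), of 0] trace_at_bound[OF that(1) _ that(2,3), of pi]
    by simp
  show "\<exists>C>0. \<forall>f\<in>space_V. (cmod (trace_at 0 f))\<^sup>2 + (cmod (trace_at pi f))\<^sup>2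
      \<le> C * (Re (form_a0 f f) powr (3/4) * norm_H f powr (1/2) + (norm_H f)\<^sup>2)"
  proof (intro exI[of _ "2 * 32"] conjI ballI)
    fix f assume f: "f \<in> space_V"
    show "(cmod (trace_at 0 f))\<^sup>2 + (cmod (trace_at pi f))\<^sup>2
        \<le> 2 * 32 * (Re (form_a0 f f) powr (3/4) * norm_H f powr (1/2) + (norm_H f)\<^sup>2)"
      by (rule optimize_epsilon)
        (use bound[OF f] form_a0_nonneg[OF f] norm_H_nonneg[of f] in auto)
  qed simp
  show "\<exists>C>0. \<forall>\<epsilon>\<in>{0<..1}. \<forall>f\<in>space_V. (cmod (trace_at 0 f))\<^sup>2 + (cmod (trace_at pi f))\<^sup>2
      \<le> C * (\<epsilon> * Re (form_a0 f f) + \<epsilon> powi (-3) * (norm_H f)\<^sup>2)"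
  proof (intro exI[of _ 32] conjI ballI)
    fix \<epsilon> f assume "\<epsilon> \<in> {0<..1::real}" "f \<in> space_V"
    moreover have powi: "\<epsilon> powi (-3) = inverse (\<epsilon> ^ 3)"
      by (simp add: power_int_minus)
    ultimately show "(cmod (trace_at 0 f))\<^sup>2 + (cmod (trace_at pi f))\<^sup>2
        \<le> 32 * (\<epsilon> * Re (form_a0 f f) + \<epsilon> powi (-3) * (norm_H f)\<^sup>2)"
      using bound[of f \<epsilon>] unfolding powi by (simp add: divide_inverse mult.commute)
  qed simp
qed (use endpoint_trace_trace_at endpoint_trace_unique in auto)

end
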